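(* Let $\xi$ be an $\mathbb{N}_0$-valued random variable with $\mathbb{P}(\xi=0)>0$ and $\mathbb{E}\,\xi>2$ whose distribution is separable, i.e. $\xi\stackrel{d}{=}X_1+X_2$ with $X_1,X_2$ independent and identically distributed integer-valued random variables. Let $p$ (resp. $\bar p$) be the probability that Breaker wins the Maker-Breaker game on the Galton-Watson tree with offspring distribution $\xi$, with the nodes carrying no further information, when Breaker (resp. Maker) starts. Then $$p=\rho\,\bigg(1-\frac{\sigma\cdot\rho_{\mathrm{odd}}}{1-\theta\cdot(1-\theta_{\mathrm{odd}})}\bigg)$$ and $$\bar p=\rho^2\,\bigg(1-\frac{2\sigma\cdot\rho_{\mathrm{odd}}\,(1-\rho_{\mathrm{odd}})}{1-\theta\cdot(1-\theta_{\mathrm{odd}})}\bigg),$$ where $\rho,\sigma,\theta,\rho_{\mathrm{odd}},\theta_{\mathrm{odd}}$ are the following quantities for the random walk $(W_n)_{n\in\mathbb{N}_0}$ on $\mathbb{Z}$ with $W_0=0$ and i.i.d. increments distributed as $X_1-1$: with $\tau_{-1}=\inf\{n:\,W_n=-1\}$ and $\tau_0^+=\inf\{n>0:\,W_n=0\}$, $$\rho=\mathbb{P}(\tau_{-1}<\infty),\quad \sigma=\mathbb{P}(W_n>0\text{ for all }n\ge1),\quad \theta=\mathbb{P}(\tau_0^+<\tau_{-1}),$$ $$\rho_{\mathrm{odd}}=\mathbb{P}(\tau_{-1}\text{ is odd}\mid\tau_{-1}<\infty),\quad \theta_{\mathrm{odd}}=\mathbb{P}(\tau_0^+\text{ is 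odd}\mid\tau_0^+<\tau_{-1}).$$
   Context: The Galton-Watson tree is the random rooted family tree with root $\mathbf{0}$ in which all individuals have independent numbers of children distributed as $\xi$. In the $(1,1)$ Maker-Breaker game the players move alternately; in each turn a player picks one available edge: Maker fixates it (securing it from deletion), Breaker removes it. Breaker wins if at some time the root lies in a finite component separated from the rest by removed edges; otherwise Maker wins. Internal nodes are those connected to the root by fixated edges (including the root); external nodes are children of internal nodes that are neither internal nor cut off. No-information regime ($I(v)=\emptyset$): the tree is explored during the game, and the players see only the internal and external nodes. In each turn a player plays an edge between an internal and an external node; all such edges are indistinguishable, so the choice is arbitrary. The number of available edges at Maker's successive turns is described by the embedded random walk $S_n=S_{n-1}+(\xi_n-2)$, $n\ge 1$, with $(\xi_n)_{n\ge1}$ i.i.d. copies of $\xi$ and $S_0=1$ if Breaker starts, $S_0=2$ if Maker starts. Maker wins iff $S_n>0$ for all $n\ge1$; that is, $p=\mathbb{P}(S_n\le 0\text{ for some }n\ge1\mid S_0=1)$ and $\bar p=\mathbb{P}(S_n\le 0\text{ for some }n\ge1\mid S_0=2)$. *)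

theory Defs
  imports "HOL-Probability.Probability" "HOL-Library.Sublist" "HOL-Library.Extended_Nat"
begin

text \<open>
  Nodes carry Ulam-Harris labels: the root is the empty list, and the children of \<open>v\<close> are
  \<open>v @ [0], \<dots>, v @ [c v - 1]\<close>, where \<open>c v\<close> is the number of children of \<open>v\<close>. Every edge is
  named by its lower endpoint.
\<close>

type_synonym node = "nat list"

definition family_tree :: "(node \<Rightarrow> nat) \<Rightarrow> node set" where
  "family_tree c = {v. \<forall>u i. prefix (u @ [i]) v \<longrightarrow> i < c u}"

text \<open>Below, \<open>F\<close> is the set of fixated edges and \<open>R\<close> the set of removed edges.\<close>

definition internal :: "(node \<Rightarrow> nat) \<Rightarrow> node set \<Rightarrow> node set" where
  "internal c F = {v \<in> family_tree c. \<forall>u. prefix u v \<and> u \<noteq> [] \<longrightarrow> u \<in> F}"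

definition root_component :: "(node \<Rightarrow> nat) \<Rightarrow> node set \<Rightarrow> node set" where
  "root_component c R = {v \<in> family_tree c. \<forall>u. prefix u v \<and> u \<noteq> [] \<longrightarrow> u \<notin> R}"

definition external :: "(node \<Rightarrow> nat) \<Rightarrow> node set \<Rightarrow> node set \<Rightarrow> node set" where
  "external c F R =
     {u @ [i] | u i. u \<in> internal c F \<and> u @ [i] \<notin> internal c F \<and> u @ [i] \<in> root_component c R}"

datatype player = Maker | Breaker

primrec opponent :: "player \<Rightarrow> player" where
  "opponent Maker = Breaker"
| "opponent Breaker = Maker"

definition mover :: "player \<Rightarrow> nat \<Rightarrow> player" where
  "mover starter n = (if even n then starter else opponent starter)"

text \<open>
  A view is what the players see: the internal and the external nodes. A strategy chooses the
  external endpoint of the edge to be played from the sequence of views so far (most recent one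
  first), and hence does not depend on any part of the tree that has not been explored yet.
\<close>

type_synonym view = "node set \<times> node set"
type_synonym strategy = "view list \<Rightarrow> node"

definition legal_strategy :: "strategy \<Rightarrow> bool" where
  "legal_strategy s \<longleftrightarrow> (\<forall>I E h. E \<noteq> {} \<longrightarrow> s ((I, E) # h) \<in> E)"

definition view_of :: "(node \<Rightarrow> nat) \<Rightarrow> node set \<Rightarrow> node set \<Rightarrow> view" where
  "view_of c F R = (internal c F, external c F R)"

text \<open>
  The history of views, the fixated edges and the removed edges after \<open>n\<close> turns. Once no edge
  can be played, nothing changes any more.
\<close>

primrec position ::
  "player \<Rightarrow> strategy \<Rightarrow> strategy \<Rightarrow> (node \<Rightarrow> nat) \<Rightarrow> nat \<Rightarrow> view list \<times> node set \<times> node set" where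
  "position starter sM sB c 0 = ([view_of c {} {}], {}, {})"
| "position starter sM sB c (Suc n) =
     (case position starter sM sB c n of (h, F, R) \<Rightarrow>
        if external c F R = {} then (h, F, R)
        else case mover starter n of
          Maker \<Rightarrow> (let F' = insert (sM h) F in (view_of c F' R # h, F', R))
        | Breaker \<Rightarrow> (let R' = insert (sB h) R in (view_of c F R' # h, F, R')))"

definition removed_edges ::
  "player \<Rightarrow> strategy \<Rightarrow> strategy \<Rightarrow> (node \<Rightarrow> nat) \<Rightarrow> nat \<Rightarrow> node set" where
  "removed_edges starter sM sB c n = snd (snd (position starter sM sB c n))"

definition breaker_wins :: "player \<Rightarrow> strategy \<Rightarrow> strategy \<Rightarrow> (node \<Rightarrow> nat) \<Rightarrow> bool" where
  "breaker_wins starter sM sB c \<longleftrightarrow>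
     (\<exists>n. finite (root_component c (removed_edges starter sM sB c n)))"

definition iid_with_law :: "'a measure \<Rightarrow> ('i \<Rightarrow> 'a \<Rightarrow> 'b) \<Rightarrow> 'b pmf \<Rightarrow> bool" where
  "iid_with_law M Z \<mu> \<longleftrightarrow>
     prob_space.indep_vars M (\<lambda>_. count_space UNIV) Z UNIV \<and>
     (\<forall>i. distr M (count_space UNIV) (Z i) = measure_pmf \<mu>)"

definition walk :: "(nat \<Rightarrow> 'a \<Rightarrow> int) \<Rightarrow> 'a \<Rightarrow> nat \<Rightarrow> int" where
  "walk Y \<omega> n = (\<Sum>i<n. Y i \<omega>)"

text \<open>In \<^typ>\<open>enat\<close>, the infimum of the empty set is \<open>\<infinity>\<close>.\<close>

definition tau_minus1 :: "(nat \<Rightarrow> int) \<Rightarrow> enat" where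
  "tau_minus1 w = Inf (enat ` {n. w n = -1})"

definition tau_0_plus :: "(nat \<Rightarrow> int) \<Rightarrow> enat" where
  "tau_0_plus w = Inf (enat ` {n. n > 0 \<and> w n = 0})"

definition odd_time :: "enat \<Rightarrow> bool" where
  "odd_time t \<longleftrightarrow> (\<exists>n. t = enat n \<and> odd n)"

end

theory Submission
  imports Defs
begin

text \<open>
  Legal strategies only explore fresh nodes, so the number of available edges is a Markov chain
  that does not depend on the strategies, and Breaker wins iff it reaches zero. Splitting
  \<open>\<xi> - 2\<close> into two steps of \<open>W\<close>, Breaker wins iff \<open>W\<close> is at or below \<open>-k\<close> at some even time, where
  \<open>k\<close> is \<open>1\<close> or \<open>2\<close> depending on who starts. As \<open>W\<close> goes down by at most one per step, one can apply
  the Markov property at the successive hitting times of \<open>-1\<close>, \<open>-2\<close>: reaching \<open>-k\<close> at an even time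
  suffices, whereas after reaching it at an odd time Breaker loses iff the remaining walk stays positive
  at all odd times. The probability \<open>q\<close> of the latter event satisfies
  \<open>q = \<sigma> + \<theta> (1 - \<theta>_odd) q\<close> by the Markov property at the first return to \<open>0\<close>.
\<close>

section \<open>Paths of skip-free walks\<close>

definition partial_sum :: "int stream \<Rightarrow> nat \<Rightarrow> int" where
  "partial_sum s n = sum_list (stake n s)"

text \<open>A relation between path and time instead of an \<open>enat\<close> value: whether it
  holds at \<open>n\<close> is decided by \<open>stake n s\<close>, which is what the Markov
  property needs.\<close>

definition hits_minus1 :: "int stream \<Rightarrow> nat \<Rightarrow> bool" where
  "hits_minus1 s n \<longleftrightarrow> partial_sum s n = -1 \<and> (\<forall>i<n. partial_sum s i \<noteq> -1)"

text \<open>For steps at least -1 this says that the first return to 0 happens at \<open>n\<close>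
  and precedes any visit to -1, since such a walk can become negative only through -1.\<close>

definition positive_return :: "int stream \<Rightarrow> nat \<Rightarrow> bool" where
  "positive_return s n \<longleftrightarrow> n > 0 \<and> partial_sum s n = 0 \<and> (\<forall>i<n. i > 0 \<longrightarrow> partial_sum s i > 0)"

text \<open>The game needs only even times, but restarting the walk at an odd hitting time swaps the
  parity, so both values of \<open>b\<close> occur; \<open>True\<close> stands for even times. The
  start counts as an even time.\<close>

definition down_at_parity :: "nat \<Rightarrow> bool \<Rightarrow> int stream \<Rightarrow> bool" where
  "down_at_parity k b s \<longleftrightarrow> (\<exists>m. even m = b \<and> int k + partial_sum s m \<le> 0)"

lemma partial_sum_0 [simp]: "partial_sum s 0 = 0"
  by (simp add: partial_sum_def)

lemma partial_sum_Suc: "partial_sum s (Suc n) = partial_sum s n + s !! n"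
  unfolding partial_sum_def stake_Suc by simp

lemma partial_sum_Stream_Suc [simp]: "partial_sum (x ## s) (Suc n) = x + partial_sum s n"
  by (simp add: partial_sum_def)

lemma partial_sum_add: "partial_sum s (n + m) = partial_sum s n + partial_sum (sdrop n s) m"
  by (induction m) (simp_all add: partial_sum_Suc sdrop_snth algebra_simps)

text \<open>At the first time at or below \<open>a\<close> the previous value is above
  \<open>a\<close> and the step is at least -1, so the walk lands exactly on \<open>a\<close>. If
  that time is 0, then \<open>a \<le> 0\<close> forces \<open>a = 0\<close>.\<close>

lemma first_passage:
  assumes "\<forall>i. s !! i \<ge> -1" "partial_sum s m \<le> a" "a \<le> 0"
  shows "\<exists>n\<le>m. partial_sum s n = a \<and> (\<forall>i<n. partial_sum s i > a)"
proof (intro exI conjI)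
  define n where "n = (LEAST n. partial_sum s n \<le> a)"
  have le: "partial_sum s n \<le> a"
    unfolding n_def using assms(2) by (rule LeastI)
  show before: "\<forall>i<n. partial_sum s i > a"
    using not_less_Least[of _ "\<lambda>n. partial_sum s n \<le> a"] by (auto simp: n_def not_le)
  show "n \<le> m"
    unfolding n_def using assms(2) by (rule Least_le)
  show "partial_sum s n = a"
  proof (cases n)
    case 0
    then show ?thesis using le assms(3) by simp
  next
    case (Suc k)
    then have "partial_sum s k > a" "partial_sum s n = partial_sum s k + s !! k" "s !! k \<ge> -1"
      using before assms(1) by (auto simp: partial_sum_Suc)
    then show ?thesis using le by linarith
  qed
qed

text \<open>On its way to \<open>- Suc k\<close> or lower the walk passes through -1. Seen from
  there the distance left is \<open>k\<close>, and the required parity of the remaining time flips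
  if the hitting time is odd.\<close>

lemma down_at_parity_Suc_iff:
  assumes "\<forall>i. s !! i \<ge> -1"
  shows "down_at_parity (Suc k) b s \<longleftrightarrow>
    (\<exists>n. hits_minus1 s n \<and> down_at_parity k (if even n then b else \<not> b) (sdrop n s))"
proof
  assume "down_at_parity (Suc k) b s"
  then obtain m where m: "even m = b" "int (Suc k) + partial_sum s m \<le> 0"
    by (auto simp: down_at_parity_def)
  then have "partial_sum s m \<le> -1" by simp
  from first_passage[OF assms this] obtain n
    where n: "n \<le> m" "partial_sum s n = -1" "\<forall>i<n. partial_sum s i > -1" by auto
  have "hits_minus1 s n" using n by (auto simp: hits_minus1_def)
  moreover have "down_at_parity k (if even n then b else \<not> b) (sdrop n s)"
    unfolding down_at_parity_def
    using m n partial_sum_add[of s n "m - n"] by (intro exI[of _ "m - n"]) auto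
  ultimately show "\<exists>n. hits_minus1 s n \<and> down_at_parity k (if even n then b else \<not> b) (sdrop n s)" by blast
next
  assume "\<exists>n. hits_minus1 s n \<and> down_at_parity k (if even n then b else \<not> b) (sdrop n s)"
  then obtain n m where "partial_sum s n = -1" "even m = (if even n then b else \<not> b)"
    "int k + partial_sum (sdrop n s) m \<le> 0"
    by (auto simp: hits_minus1_def down_at_parity_def)
  then show "down_at_parity (Suc k) b s"
    unfolding down_at_parity_def
    by (intro exI[of _ "n + m"]) (auto simp: partial_sum_add split: if_splits)
qed

text \<open>
  A walk that is positive at all odd times and has a zero can only reach it at an even time, and
  it restarts there with the same property.
\<close>

lemma positive_at_odd_times_iff:
  assumes "\<forall>i. s !! i \<ge> -1"
  shows "\<not> down_at_parity 0 False s \<longleftrightarrow>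
    (\<forall>n\<ge>1. partial_sum s n > 0) \<or>
    (\<exists>n. even n \<and> positive_return s n \<and> \<not> down_at_parity 0 False (sdrop n s))"
    (is "?L \<longleftrightarrow> ?P \<or> ?R")
proof
  assume L: ?L
  show "?P \<or> ?R"
  proof (rule disjCI)
    assume nR: "\<not> ?R"
    show ?P
    proof (rule ccontr)
      assume "\<not> ?P"
      then obtain j where j: "j \<ge> 1 \<and> partial_sum s j \<le> 0" by (auto simp: not_less)
      define n where "n = (LEAST n. n \<ge> 1 \<and> partial_sum s n \<le> 0)"
      have n: "n \<ge> 1" "partial_sum s n \<le> 0"
        using LeastI[of "\<lambda>n. n \<ge> 1 \<and> partial_sum s n \<le> 0", OF j] by (auto simp: n_def)
      have before: "\<forall>i<n. i > 0 \<longrightarrow> partial_sum s i > 0"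
        using not_less_Least[of _ "\<lambda>n. n \<ge> 1 \<and> partial_sum s n \<le> 0"] by (force simp: n_def)
      have ev: "even n" using L n by (auto simp: down_at_parity_def)
      obtain k where k: "n = Suc k" using n by (cases n) auto
      \<comment> \<open>An even \<open>n \<ge> 1\<close> is at least 2, so \<open>k\<close> is not
        the start and minimality of \<open>n\<close> applies to it: a step of at least -1 from a
        positive value to one at most 0 ends exactly at 0.\<close>
      have "k > 0" using k ev by (cases k) auto
      then have "partial_sum s k > 0" using before k by auto
      then have "partial_sum s n = 0"
        using n(2) assms by (auto simp: k partial_sum_Suc dest: spec[of _ k])
      then have "positive_return s n" using before n by (auto simp: positive_return_def)
      moreover have "\<not> down_at_parity 0 False (sdrop n s)"
      proof
        assume "down_at_parity 0 False (sdrop n s)"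
        then obtain m where "odd m" "partial_sum (sdrop n s) m \<le> 0"
          by (auto simp: down_at_parity_def)
        then have "odd (n + m)" "partial_sum s (n + m) \<le> 0"
          using ev \<open>partial_sum s n = 0\<close> by (auto simp: partial_sum_add)
        then show False using L unfolding down_at_parity_def by fastforce
      qed
      ultimately show False using nR ev by auto
    qed
  qed
next
  assume "?P \<or> ?R"
  then show ?L
  proof
    assume P: ?P
    have "partial_sum s m > 0" if "odd m" for m
      using P odd_pos[OF that] by (simp add: Suc_le_eq)
    then show ?L by (auto simp: down_at_parity_def not_le)
  next
    assume ?R
    then obtain n where n: "even n" "positive_return s n" "\<not> down_at_parity 0 False (sdrop n s)"
      by auto
    have "partial_sum s m > 0" if "odd m" for m
    proof (cases "m < n")
      case True
      then show ?thesis using n(2) \<open>odd m\<close> by (auto simp: positive_return_def odd_pos)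
    next
      case False
      then obtain l where l: "m = n + l" using le_Suc_ex not_le by blast
      then have "odd l" using \<open>odd m\<close> n by auto
      then have "partial_sum (sdrop n s) l > 0"
        using n(3) by (auto simp: down_at_parity_def not_le)
      then show ?thesis using n(2) l by (simp add: partial_sum_add positive_return_def)
    qed
    then show ?L by (auto simp: down_at_parity_def not_le)
  qed
qed

section \<open>Stopping times as infima in the extended naturals\<close>

lemma Inf_enat_image_eq_enat_iff: "Inf (enat ` A) = enat n \<longleftrightarrow> n \<in> A \<and> (\<forall>i<n. i \<notin> A)"
proof
  assume eq: "Inf (enat ` A) = enat n"
  then have "A \<noteq> {}" by (auto simp: top_enat_def)
  then have "Inf (enat ` A) \<in> enat ` A"
    by (auto simp: Inf_enat_def intro: LeastI)
  moreover have "i \<notin> A" if "i < n" for i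
    using that eq Inf_lower[of "enat i" "enat ` A"] by auto
  ultimately show "n \<in> A \<and> (\<forall>i<n. i \<notin> A)" using eq by auto
next
  assume "n \<in> A \<and> (\<forall>i<n. i \<notin> A)"
  then show "Inf (enat ` A) = enat n"
    by (intro antisym Inf_lower Inf_greatest) (auto simp: not_less[symmetric])
qed

lemma tau_minus1_eq_iff: "tau_minus1 (partial_sum s) = enat n \<longleftrightarrow> hits_minus1 s n"
  by (auto simp: tau_minus1_def hits_minus1_def Inf_enat_image_eq_enat_iff)

lemma tau_minus1_finite_iff: "tau_minus1 (partial_sum s) < \<infinity> \<longleftrightarrow> (\<exists>n. hits_minus1 s n)"
  unfolding tau_minus1_eq_iff[symmetric] by (metis enat_ord_simps(4) not_enat_eq)

lemma odd_tau_minus1_iff: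
  "odd_time (tau_minus1 (partial_sum s)) \<longleftrightarrow> (\<exists>n. odd n \<and> hits_minus1 s n)"
  by (auto simp: odd_time_def tau_minus1_eq_iff)

text \<open>No bound on the steps is assumed: measurability of the event needs a description that is
  valid on every path, whereas \<open>positive_return\<close> matches it only for steps at least
  -1.\<close>

lemma return_before_minus1_at_iff:
  "tau_0_plus (partial_sum s) = enat n \<and> enat n < tau_minus1 (partial_sum s) \<longleftrightarrow>
    n > 0 \<and> partial_sum s n = 0 \<and> (\<forall>i<n. i > 0 \<longrightarrow> partial_sum s i \<noteq> 0) \<and>
    (\<forall>i\<le>n. partial_sum s i \<noteq> -1)"
proof -
  have "enat n < tau_minus1 (partial_sum s) \<longleftrightarrow> (\<forall>i\<le>n. partial_sum s i \<noteq> -1)"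
  proof
    assume "enat n < tau_minus1 (partial_sum s)"
    then have "n < i" if "partial_sum s i = -1" for i
      using Inf_lower[of "enat i" "enat ` {n. partial_sum s n = -1}"] that
      by (auto simp: tau_minus1_def dest: less_le_trans)
    then show "\<forall>i\<le>n. partial_sum s i \<noteq> -1" by force
  next
    assume *: "\<forall>i\<le>n. partial_sum s i \<noteq> -1"
    show "enat n < tau_minus1 (partial_sum s)"
    proof (cases "tau_minus1 (partial_sum s)")
      case (enat m)
      then have "partial_sum s m = -1" by (simp add: tau_minus1_eq_iff hits_minus1_def)
      then show ?thesis using * enat by (auto simp: not_le[symmetric])
    qed simp
  qed
  then show ?thesis
    by (auto simp: tau_0_plus_def Inf_enat_image_eq_enat_iff)
qed

text \<open>By \<open>first_passage\<close>, avoiding -1 is the same as staying nonnegative;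
  avoiding 0 as well makes the values strictly positive.\<close>

lemma positive_return_iff:
  assumes "\<forall>i. s !! i \<ge> -1"
  shows "tau_0_plus (partial_sum s) = enat n \<and> enat n < tau_minus1 (partial_sum s) \<longleftrightarrow>
    positive_return s n"
proof -
  have "(\<forall>i\<le>n. partial_sum s i \<noteq> -1) \<longleftrightarrow> (\<forall>i\<le>n. partial_sum s i \<ge> 0)"
  proof
    assume *: "\<forall>i\<le>n. partial_sum s i \<noteq> -1"
    show "\<forall>i\<le>n. partial_sum s i \<ge> 0"
    proof (intro allI impI leI notI)
      fix i assume "i \<le> n" "partial_sum s i < 0"
      then have "partial_sum s i \<le> -1" by simp
      from first_passage[OF assms this] obtain j where "j \<le> i" "partial_sum s j = -1" by auto
      then show False using * \<open>i \<le> n\<close> by auto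
    qed
  qed force
  then show ?thesis
    unfolding return_before_minus1_at_iff positive_return_def by (fastforce simp: order_le_less)
qed

text \<open>A time strictly below another one is finite, so the event is a countable union over its
  value.\<close>

lemma return_before_minus1_iff_Ex:
  "tau_0_plus (partial_sum s) < tau_minus1 (partial_sum s) \<longleftrightarrow>
    (\<exists>n. tau_0_plus (partial_sum s) = enat n \<and> enat n < tau_minus1 (partial_sum s))"
  by (metis enat_ord_simps(6) not_enat_eq)

lemma odd_return_before_minus1_iff_Ex:
  "odd_time (tau_0_plus (partial_sum s)) \<and>
      tau_0_plus (partial_sum s) < tau_minus1 (partial_sum s) \<longleftrightarrow>
    (\<exists>n. odd n \<and> tau_0_plus (partial_sum s) = enat n \<and> enat n < tau_minus1 (partial_sum s))"
  by (auto simp: odd_time_def)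

lemma return_before_minus1_iff:
  assumes "\<forall>i. s !! i \<ge> -1"
  shows "tau_0_plus (partial_sum s) < tau_minus1 (partial_sum s) \<longleftrightarrow> (\<exists>n. positive_return s n)"
  unfolding return_before_minus1_iff_Ex positive_return_iff[OF assms] ..

lemma odd_return_before_minus1_iff:
  assumes "\<forall>i. s !! i \<ge> -1"
  shows "odd_time (tau_0_plus (partial_sum s)) \<and>
      tau_0_plus (partial_sum s) < tau_minus1 (partial_sum s) \<longleftrightarrow>
    (\<exists>n. odd n \<and> positive_return s n)"
  unfolding odd_return_before_minus1_iff_Ex positive_return_iff[OF assms] ..

lemma hits_minus1_unique: "hits_minus1 s m \<Longrightarrow> hits_minus1 s n \<Longrightarrow> m = n"
  by (rule linorder_cases[of m n]) (auto simp: hits_minus1_def)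

lemma positive_return_unique: "positive_return s m \<Longrightarrow> positive_return s n \<Longrightarrow> m = n"
  by (rule linorder_cases[of m n]) (auto simp: positive_return_def)

text \<open>Brings the event into the form required by \<open>strong_markov\<close>: membership of
  the first \<open>n\<close> steps in a set of lists.\<close>

lemma hits_minus1_iff_stake:
  "hits_minus1 s n \<longleftrightarrow>
     stake n s \<in> {l. sum_list l = -1 \<and> (\<forall>i<n. sum_list (take i l) \<noteq> -1)}"
proof -
  have "sum_list (take i (stake n s)) = partial_sum s i" if "i < n" for i
    using that by (simp add: partial_sum_def take_stake min_def)
  then show ?thesis by (simp add: hits_minus1_def flip: partial_sum_def)
qed

lemma positive_return_iff_stake:
  "positive_return s n \<longleftrightarrow>
     stake n s \<in> {l. n > 0 \<and> sum_list l = 0 \<and> (\<forall>i<n. i > 0 \<longrightarrow> sum_list (take i l) > 0)}"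
proof -
  have "sum_list (take i (stake n s)) = partial_sum s i" if "i < n" for i
    using that by (simp add: partial_sum_def take_stake min_def)
  then show ?thesis by (simp add: positive_return_def flip: partial_sum_def)
qed

section \<open>Random walks as random streams\<close>

abbreviation iid_stream :: "'a pmf \<Rightarrow> 'a stream measure" where
  "iid_stream Q \<equiv> stream_space (measure_pmf Q)"

lemma space_iid_stream [simp]: "space (iid_stream Q) = UNIV"
  by (simp add: space_stream_space)

lemma prob_space_iid_stream: "prob_space (iid_stream Q)"
  by (rule prob_space.prob_space_stream_space[OF measure_pmf.prob_space_axioms])

lemma measurable_stake_iid_stream [measurable]:
  "stake n \<in> measurable (iid_stream (Q :: 'a::countable pmf)) (count_space UNIV)"
proof -
  have "sets (iid_stream Q) = sets (stream_space (count_space UNIV))"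
    by (rule sets_stream_space_cong) simp
  from measurable_cong_sets[OF this refl] measurable_stake show ?thesis by blast
qed

lemma measurable_partial_sum [measurable]:
  "(\<lambda>s. partial_sum s n) \<in> measurable (iid_stream Q) (count_space UNIV)"
  unfolding partial_sum_def by measurable

lemma measurable_down_at_parity [measurable]:
  "Measurable.pred (iid_stream Q) (down_at_parity k b)"
proof -
  have [measurable]: "Measurable.pred (iid_stream Q) (\<lambda>s. int k + partial_sum s m \<le> 0)" for m
    by (rule measurable_compose[OF measurable_partial_sum]) simp
  show ?thesis unfolding down_at_parity_def[abs_def] by measurable
qed

lemma sets_iid_stream_Collect:
  "Measurable.pred (iid_stream Q) P \<Longrightarrow> {s. P s} \<in> sets (iid_stream Q)"
  by (simp add: pred_def)

text \<open>Induction on \<open>n\<close>, integrating out the first step \<open>t\<close>. This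
  replaces \<open>A\<close> by the set of tails \<open>l\<close> with \<open>t # l \<in> A\<close>,
  hence \<open>A\<close> is arbitrary in the induction.\<close>

lemma stake_sdrop_independent:
  fixes A :: "'a::countable list set"
  assumes [measurable]: "Measurable.pred (iid_stream Q) P"
  shows "emeasure (iid_stream Q) {s. stake n s \<in> A \<and> P (sdrop n s)} =
    emeasure (iid_stream Q) {s. stake n s \<in> A} * emeasure (iid_stream Q) {s. P s}"
proof (induction n arbitrary: A)
  case 0
  interpret prob_space "iid_stream Q" by (rule prob_space_iid_stream)
  show ?case
    using emeasure_space_1 by (cases "[] \<in> A") auto
next
  case (Suc n)
  have meas: "{s. stake n s \<in> B \<and> P (sdrop n s)} \<in> sets (iid_stream Q)"
    "{s. stake n s \<in> B} \<in> sets (iid_stream Q)" for n B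
    by (rule sets_iid_stream_Collect; measurable)+
  have "emeasure (iid_stream Q) {s. stake (Suc n) s \<in> A \<and> P (sdrop (Suc n) s)} =
    (\<integral>\<^sup>+t. emeasure (iid_stream Q) {s. stake n s \<in> {l. t # l \<in> A} \<and> P (sdrop n s)} \<partial>measure_pmf Q)"
    by (subst prob_space.emeasure_stream_space[OF measure_pmf.prob_space_axioms meas(1)]) simp
  also have "\<dots> = (\<integral>\<^sup>+t. emeasure (iid_stream Q) {s. stake n s \<in> {l. t # l \<in> A}} \<partial>measure_pmf Q)
      * emeasure (iid_stream Q) {s. P s}"
    unfolding Suc.IH by (rule nn_integral_multc) simp
  also have "(\<integral>\<^sup>+t. emeasure (iid_stream Q) {s. stake n s \<in> {l. t # l \<in> A}} \<partial>measure_pmf Q) =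
     emeasure (iid_stream Q) {s. stake (Suc n) s \<in> A}"
    by (subst prob_space.emeasure_stream_space[OF measure_pmf.prob_space_axioms meas(2)]) simp
  finally show ?case .
qed

text \<open>\<open>A n\<close> collects the initial segments that stop at time \<open>n\<close>, and
  \<open>disj\<close> says that a path stops at most once. The events for different \<open>n\<close>
  are therefore disjoint, and independence at the fixed times can be summed over \<open>n\<close>.
  The set \<open>I\<close> serves to select the parity of the stopping time.\<close>

lemma strong_markov:
  fixes A :: "nat \<Rightarrow> 'a::countable list set"
  assumes [measurable]: "Measurable.pred (iid_stream Q) P"
    and disj: "\<And>s m n. stake m s \<in> A m \<Longrightarrow> stake n s \<in> A n \<Longrightarrow> m = n"
  shows "measure (iid_stream Q) {s. \<exists>n\<in>I. stake n s \<in> A n \<and> P (sdrop n s)} =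
    measure (iid_stream Q) {s. \<exists>n\<in>I. stake n s \<in> A n} * measure (iid_stream Q) {s. P s}"
proof -
  have meas: "{s. stake n s \<in> A n \<and> R (sdrop n s)} \<in> sets (iid_stream Q)"
    if [measurable]: "Measurable.pred (iid_stream Q) R" for n R
    by (rule sets_iid_stream_Collect; measurable)
  have dj: "disjoint_family_on (\<lambda>n. {s. stake n s \<in> A n \<and> R (sdrop n s)}) I" for R
    using disj by (auto simp: disjoint_family_on_def)
  have *: "emeasure (iid_stream Q) {s. \<exists>n\<in>I. stake n s \<in> A n \<and> R (sdrop n s)} =
      (\<integral>\<^sup>+n. emeasure (iid_stream Q) {s. stake n s \<in> A n} \<partial>count_space I) *
      emeasure (iid_stream Q) {s. R s}"
    if R: "Measurable.pred (iid_stream Q) R" for R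
  proof -
    have "{s. \<exists>n\<in>I. stake n s \<in> A n \<and> R (sdrop n s)} =
        (\<Union>n\<in>I. {s. stake n s \<in> A n \<and> R (sdrop n s)})" by auto
    then show ?thesis
      by (simp add: emeasure_UN_countable meas[OF R] dj stake_sdrop_independent[OF R]
          nn_integral_multc)
  qed
  interpret prob_space "iid_stream Q" by (rule prob_space_iid_stream)
  \<comment> \<open>With the always true predicate the same formula identifies the sum over
    \<open>n\<close> as the probability of stopping.\<close>
  from *[of "\<lambda>_. True"] have "emeasure (iid_stream Q) {s. \<exists>n\<in>I. stake n s \<in> A n} =
      (\<integral>\<^sup>+n. emeasure (iid_stream Q) {s. stake n s \<in> A n} \<partial>count_space I)"
    using emeasure_space_1 by simp
  with *[OF assms(1)] show ?thesis
    by (simp add: measure_def enn2real_mult)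
qed

section \<open>Hitting and return probabilities of a skip-free walk\<close>

locale skip_free_walk =
  fixes Q :: "int pmf"
  assumes steps_ge: "set_pmf Q \<subseteq> {-1..}"
begin

sublocale prob_space "iid_stream Q" by (rule prob_space_iid_stream)

lemma AE_steps_ge: "AE s in iid_stream Q. \<forall>i. s !! i \<ge> -1"
proof -
  have "AE x in measure_pmf Q. x \<ge> -1" using steps_ge by (auto simp: AE_measure_pmf_iff)
  from prob_space.AE_stream_all[OF measure_pmf.prob_space_axioms _ this] show ?thesis
    by (simp del: stream_all_iff add: stream_all_def)
qed

text \<open>Unconditional probabilities, so that no division is involved: all times give
  \<open>\<rho>\<close>, and odd times give \<open>\<rho> * \<rho>_odd\<close>.\<close>

definition hit_prob :: "nat set \<Rightarrow> real" where
  "hit_prob I = prob {s. \<exists>n\<in>I. hits_minus1 s n}"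

text \<open>All times give \<open>\<theta>\<close>, and even times give
  \<open>\<theta> * (1 - \<theta>_odd)\<close>.\<close>

definition return_prob :: "nat set \<Rightarrow> real" where
  "return_prob I = prob {s. \<exists>n\<in>I. positive_return s n}"

lemma measurable_hits_minus1 [measurable]: "Measurable.pred (iid_stream Q) (\<lambda>s. hits_minus1 s n)"
  unfolding hits_minus1_def by measurable

lemma measurable_positive_return [measurable]:
  "Measurable.pred (iid_stream Q) (\<lambda>s. positive_return s n)"
  unfolding positive_return_def by measurable

lemma hit_strong_markov:
  assumes "Measurable.pred (iid_stream Q) P"
  shows "prob {s. \<exists>n\<in>I. hits_minus1 s n \<and> P (sdrop n s)} = hit_prob I * prob {s. P s}"
  unfolding hit_prob_def hits_minus1_iff_stake
  by (rule strong_markov[OF assms]) (unfold hits_minus1_iff_stake[symmetric], rule hits_minus1_unique)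

lemma return_strong_markov:
  assumes "Measurable.pred (iid_stream Q) P"
  shows "prob {s. \<exists>n\<in>I. positive_return s n \<and> P (sdrop n s)} = return_prob I * prob {s. P s}"
  unfolding return_prob_def positive_return_iff_stake
  by (rule strong_markov[OF assms]) (unfold positive_return_iff_stake[symmetric], rule positive_return_unique)

lemma prob_down_at_parity_Suc:
  "prob {s. down_at_parity (Suc k) b s} =
     hit_prob {n. even n} * prob {s. down_at_parity k b s} +
     hit_prob {n. odd n} * prob {s. down_at_parity k (\<not> b) s}"
proof -
  let ?E = "{s. \<exists>n\<in>{n. even n}. hits_minus1 s n \<and> down_at_parity k b (sdrop n s)}"
  let ?O = "{s. \<exists>n\<in>{n. odd n}. hits_minus1 s n \<and> down_at_parity k (\<not> b) (sdrop n s)}"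
  have EO [measurable]: "?E \<in> events" "?O \<in> events"
    by (rule sets_iid_stream_Collect; measurable)+
  \<comment> \<open>The decomposition by the parity of the hitting time holds on paths with steps at
    least -1, hence almost surely, which suffices for probabilities.\<close>
  have "AE s in iid_stream Q. s \<in> {s. down_at_parity (Suc k) b s} \<longleftrightarrow> s \<in> ?E \<union> ?O"
    using AE_steps_ge
  proof eventually_elim
    case (elim s)
    then show ?case unfolding Un_iff mem_Collect_eq down_at_parity_Suc_iff[OF elim] by (auto split: if_splits)
  qed
  then have "prob {s. down_at_parity (Suc k) b s} = prob (?E \<union> ?O)"
    by (rule finite_measure_eq_AE) (intro sets_iid_stream_Collect measurable_down_at_parity sets.Un EO)+
  also have "\<dots> = prob ?E + prob ?O"
    by (rule finite_measure_Union[OF EO]) (auto dest: hits_minus1_unique)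
  finally show ?thesis by (simp only: hit_strong_markov measurable_down_at_parity)
qed

lemma hit_prob_split: "hit_prob UNIV = hit_prob {n. even n} + hit_prob {n. odd n}"
proof -
  have "{s. \<exists>n. hits_minus1 s n} =
      {s. \<exists>n\<in>{n. even n}. hits_minus1 s n} \<union> {s. \<exists>n\<in>{n. odd n}. hits_minus1 s n}" by auto
  moreover have "prob \<dots> = hit_prob {n. even n} + hit_prob {n. odd n}"
    unfolding hit_prob_def
  proof (rule finite_measure_Union)
    show "{s. \<exists>n\<in>{n. even n}. hits_minus1 s n} \<in> events" "{s. \<exists>n\<in>{n. odd n}. hits_minus1 s n} \<in> events"
      by (rule sets_iid_stream_Collect; measurable)+
  qed (auto dest: hits_minus1_unique)
  ultimately show ?thesis by (simp add: hit_prob_def)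
qed

lemma return_prob_split: "return_prob UNIV = return_prob {n. even n} + return_prob {n. odd n}"
proof -
  have "{s. \<exists>n. positive_return s n} =
      {s. \<exists>n\<in>{n. even n}. positive_return s n} \<union> {s. \<exists>n\<in>{n. odd n}. positive_return s n}" by auto
  moreover have "prob \<dots> = return_prob {n. even n} + return_prob {n. odd n}"
    unfolding return_prob_def
  proof (rule finite_measure_Union)
    show "{s. \<exists>n\<in>{n. even n}. positive_return s n} \<in> events" "{s. \<exists>n\<in>{n. odd n}. positive_return s n} \<in> events"
      by (rule sets_iid_stream_Collect; measurable)+
  qed (auto dest: positive_return_unique)
  ultimately show ?thesis by (simp add: return_prob_def)
qed

text \<open>After a return to 0 at an even time, the odd times of the remaining walk are odd times
  of the whole walk, so the same probability reappears and yields a linear equation for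
  \<open>q\<close>.\<close>

lemma prob_positive_at_odd_times:
  defines "q \<equiv> prob {s. \<not> down_at_parity 0 False s}"
  shows "q = prob {s. \<forall>n\<ge>1. partial_sum s n > 0} + return_prob {n. even n} * q"
proof -
  let ?P = "{s. \<forall>n\<ge>1. partial_sum s n > 0}"
  let ?R = "{s. \<exists>n\<in>{n. even n}. positive_return s n \<and> \<not> down_at_parity 0 False (sdrop n s)}"
  have PR: "?P \<in> events" "?R \<in> events"
    by (rule sets_iid_stream_Collect; measurable)+
  have "AE s in iid_stream Q. s \<in> {s. \<not> down_at_parity 0 False s} \<longleftrightarrow> s \<in> ?P \<union> ?R"
    using AE_steps_ge
  proof eventually_elim
    case (elim s)
    then show ?case by (auto simp: positive_at_odd_times_iff)
  qed
  then have "q = prob (?P \<union> ?R)"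
    unfolding q_def by (rule finite_measure_eq_AE) (use PR in \<open>auto intro: sets_iid_stream_Collect\<close>)
  also have "\<dots> = prob ?P + prob ?R"
  proof (rule finite_measure_Union[OF PR])
    have "\<not> (\<forall>n\<ge>1. partial_sum s n > 0)" if "positive_return s n" for s n
      using that by (auto simp: positive_return_def intro!: exI[of _ n])
    then show "?P \<inter> ?R = {}" by blast
  qed
  also have "prob ?R = return_prob {n. even n} * q"
    unfolding q_def by (rule return_strong_markov) measurable
  finally show ?thesis .
qed

text \<open>A path whose first step is -1 has no positive return. The strict inequality makes the
  linear equation for \<open>q\<close> solvable.\<close>

lemma return_prob_less_1:
  assumes "pmf Q (-1) > 0"
  shows "return_prob I < 1"
proof -
  let ?D = "{s. stake 1 s \<in> {[-1]}}"
  have D: "?D \<in> events" by (rule sets_iid_stream_Collect; measurable)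
  have R: "{s. \<exists>n\<in>I. positive_return s n} \<in> events" by (rule sets_iid_stream_Collect; measurable)
  have "emeasure (iid_stream Q) ?D = (\<integral>\<^sup>+t. of_bool (t = -1) \<partial>measure_pmf Q)"
    by (subst prob_space.emeasure_stream_space[OF measure_pmf.prob_space_axioms D])
      (use emeasure_space_1 in \<open>simp add: of_bool_def if_distrib cong: if_cong\<close>)
  also have "\<dots> = (\<integral>\<^sup>+t. indicator {-1} t \<partial>measure_pmf Q)"
    by (intro nn_integral_cong) (simp add: indicator_def)
  also have "\<dots> = ennreal (pmf Q (-1))"
    by (simp add: emeasure_pmf_single)
  finally have "prob ?D = pmf Q (-1)"
    by (simp add: measure_def)
  moreover have "AE s in iid_stream Q. s \<in> {s. \<exists>n\<in>I. positive_return s n} \<longrightarrow> s \<in> UNIV - ?D"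
    using AE_steps_ge
  proof eventually_elim
    case (elim s)
    have "stake 1 s \<noteq> [-1]" if "positive_return s n" for n
    proof
      assume "stake 1 s = [-1]"
      then have "partial_sum s 1 = -1" by (simp add: partial_sum_def)
      then show False
        using that by (cases "n = 1") (auto simp: positive_return_def dest!: spec[of _ 1])
    qed
    then show ?case by blast
  qed
  then have "return_prob I \<le> prob (space (iid_stream Q) - ?D)"
    unfolding return_prob_def using sets.compl_sets[OF D] by (intro finite_measure_mono_AE) simp_all
  ultimately show ?thesis
    using assms prob_compl[OF D] by simp
qed

lemma prob_down_at_even_times:
  assumes "pmf Q (-1) > 0"
  defines "q \<equiv> prob {s. \<forall>n\<ge>1. partial_sum s n > 0} / (1 - return_prob {n. even n})"
  shows "prob {s. down_at_parity 1 True s} = hit_prob UNIV - hit_prob {n. odd n} * q"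
    and "prob {s. down_at_parity 2 True s} =
      (hit_prob UNIV)\<^sup>2 - 2 * hit_prob {n. odd n} * (hit_prob UNIV - hit_prob {n. odd n}) * q"
proof -
  have "prob {s. \<not> down_at_parity 0 False s} = q"
    using prob_positive_at_odd_times return_prob_less_1[OF assms(1), of "{n. even n}"]
    unfolding q_def by (simp add: field_simps)
  moreover have "prob (space (iid_stream Q) - {s. down_at_parity 0 False s}) =
      1 - prob {s. down_at_parity 0 False s}"
    by (rule prob_compl[OF sets_iid_stream_Collect]) measurable
  ultimately have odd: "prob {s. down_at_parity 0 False s} = 1 - q"
    by (simp add: Collect_neg_eq Compl_eq_Diff_UNIV)
  \<comment> \<open>At distance 0 the start itself, an even time, is a witness.\<close>
  have "down_at_parity 0 True s" for s
    unfolding down_at_parity_def by (intro exI[of _ 0]) auto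
  then have even: "prob {s. down_at_parity 0 True s} = 1"
    using prob_space by simp
  show "prob {s. down_at_parity 1 True s} = hit_prob UNIV - hit_prob {n. odd n} * q"
    using prob_down_at_parity_Suc[of 0 True] by (simp add: hit_prob_split even odd algebra_simps)
  show "prob {s. down_at_parity 2 True s} =
      (hit_prob UNIV)\<^sup>2 - 2 * hit_prob {n. odd n} * (hit_prob UNIV - hit_prob {n. odd n}) * q"
    \<comment> \<open>Let e and o be the hitting probabilities for even and odd times and h = e + o.
      From distance 1 the probabilities are h - o q for even times and h - e q for odd times, so
      distance 2 gives e (h - o q) + o (h - e q) = h^2 - 2 e o q.\<close>
    using prob_down_at_parity_Suc[of 1 True] prob_down_at_parity_Suc[of 0 True]
      prob_down_at_parity_Suc[of 0 False]
    by (simp add: numeral_2_eq_2 hit_prob_split even odd power2_eq_square algebra_simps)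
qed

end

section \<open>Positions of the game\<close>

text \<open>The root is internal without being the lower endpoint of an edge, hence the \<open>insert []\<close>.\<close>

definition game_state :: "(node \<Rightarrow> nat) \<Rightarrow> node set \<Rightarrow> node set \<Rightarrow> bool" where
  "game_state c F R \<longleftrightarrow> finite F \<and> internal c F = insert [] F \<and> R \<inter> internal c F = {} \<and>
     (\<forall>r\<in>R. \<exists>u\<in>internal c F. \<exists>i. r = u @ [i])"

lemma Nil_internal [simp]: "[] \<in> internal c F"
  by (simp add: internal_def family_tree_def)

lemma family_tree_snoc: "u @ [i] \<in> family_tree c \<longleftrightarrow> u \<in> family_tree c \<and> i < c u"
  by (auto simp: family_tree_def prefix_snoc)

lemma internal_snoc: "u @ [i] \<in> internal c F \<longleftrightarrow> u \<in> internal c F \<and> i < c u \<and> u @ [i] \<in> F"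
  by (auto simp: internal_def family_tree_snoc prefix_snoc)

lemma root_component_snoc:
  "u @ [i] \<in> root_component c R \<longleftrightarrow> u \<in> root_component c R \<and> i < c u \<and> u @ [i] \<notin> R"
  by (auto simp: root_component_def family_tree_snoc prefix_snoc)

lemma internal_prefix: "v \<in> internal c F \<Longrightarrow> prefix u v \<Longrightarrow> u \<in> internal c F"
  unfolding internal_def family_tree_def using prefix_order.trans by blast

lemma internal_subset_root_component:
  assumes "R \<inter> internal c F = {}"
  shows "internal c F \<subseteq> root_component c R"
proof
  fix v assume v: "v \<in> internal c F"
  have "u \<notin> R" if "prefix u v" for u using internal_prefix[OF v that] assms by blast
  then show "v \<in> root_component c R" using v by (simp add: root_component_def internal_def)
qed

lemma root_component_antimono: "R \<subseteq> R' \<Longrightarrow> root_component c R' \<subseteq> root_component c R"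
  by (auto simp: root_component_def)

text \<open>In a consistent position all conditions on prefixes hold automatically. What is left
  refers to \<open>c\<close> only at the root and the fixated nodes, so unexplored parts of the tree
  do not matter.\<close>

lemma external_eq:
  assumes "game_state c F R"
  shows "external c F R = {u @ [i] | u i. u \<in> insert [] F \<and> i < c u \<and> u @ [i] \<notin> F \<and> u @ [i] \<notin> R}"
proof -
  have "u \<in> root_component c R" if "u \<in> internal c F" for u
    using that internal_subset_root_component[of R c F] assms unfolding game_state_def by blast
  then show ?thesis
    using assms unfolding external_def game_state_def by (auto simp: root_component_snoc)
qed

lemma finite_external:
  assumes "game_state c F R"
  shows "finite (external c F R)"
proof -
  have "external c F R \<subseteq> (\<Union>u\<in>insert [] F. (\<lambda>i. u @ [i]) ` {..<c u})"
    by (auto simp: external_eq[OF assms])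
  then show ?thesis
    by (rule finite_subset) (use assms in \<open>auto simp: game_state_def\<close>)
qed

lemma game_state_initial: "game_state c {} {}"
  by (auto simp: game_state_def internal_def family_tree_def)

lemma external_initial: "external c {} {} = {[i] | i. i < c []}"
  by (auto simp: external_eq[OF game_state_initial])

lemma
  assumes gs: "game_state c F R" and r: "r \<in> external c F R"
  shows game_state_remove: "game_state c F (insert r R)"
    and external_remove: "external c F (insert r R) = external c F R - {r}"
proof -
  show *: "game_state c F (insert r R)"
    using gs r by (auto simp: game_state_def external_def)
  show "external c F (insert r R) = external c F R - {r}"
    unfolding external_eq[OF gs] external_eq[OF *] by blast
qed

text \<open>Since \<open>v\<close> is not internal before the move, none of its children can have
  been fixated, removed or external. Hence all \<open>c v\<close> children are new, and the number
  of playable edges changes by \<open>c v - 1\<close>.\<close>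

lemma
  assumes gs: "game_state c F R" and v: "v \<in> external c F R"
  shows game_state_fixate: "game_state c (insert v F) R"
    and external_fixate:
      "external c (insert v F) R = (external c F R - {v}) \<union> {v @ [i] | i. i < c v}"
    and card_external_fixate:
      "card (external c (insert v F) R) = card (external c F R) - 1 + c v"
proof -
  obtain u i where ui: "v = u @ [i]" "u \<in> internal c F" "i < c u" "v \<notin> R" "v \<notin> internal c F"
    using v by (auto simp: external_def root_component_snoc)
  have "internal c F \<subseteq> internal c (insert v F)" by (auto simp: internal_def)
  with ui have "v \<in> internal c (insert v F)" by (auto simp: internal_snoc)
  moreover have "w \<in> insert v (insert [] F)" if "w \<in> internal c (insert v F)" for w
    using that by (auto simp: internal_def)
  ultimately have int: "internal c (insert v F) = insert v (internal c F)"
    using gs \<open>internal c F \<subseteq> internal c (insert v F)\<close> by (auto simp: game_state_def)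
  show *: "game_state c (insert v F) R"
    using gs ui(4) by (auto simp: game_state_def int)
  have new: "v @ [j] \<notin> F" "v @ [j] \<notin> R" "v @ [j] \<noteq> v" "v @ [j] \<notin> external c F R" for j
  proof -
    show "v @ [j] \<notin> F"
      using gs ui(5) internal_snoc[of v j c F] by (auto simp: game_state_def)
    show "v @ [j] \<notin> R" using gs ui(5) by (auto simp: game_state_def)
    show "v @ [j] \<noteq> v" by simp
    show "v @ [j] \<notin> external c F R" using ui(5) by (auto simp: external_def)
  qed
  show ext: "external c (insert v F) R = (external c F R - {v}) \<union> {v @ [i] | i. i < c v}"
    unfolding external_eq[OF gs] external_eq[OF *] using new by auto
  have "card {v @ [i] | i. i < c v} = card ((\<lambda>i. v @ [i]) ` {..<c v})"
    by (rule arg_cong[of _ _ card]) auto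
  also have "\<dots> = c v" by (simp add: card_image inj_on_def)
  finally have "card {v @ [i] | i. i < c v} = c v" .
  moreover have "finite {v @ [i] | i. i < c v}" by simp
  moreover have "(external c F R - {v}) \<inter> {v @ [i] | i. i < c v} = {}" using new by auto
  ultimately show "card (external c (insert v F) R) = card (external c F R) - 1 + c v"
    unfolding ext using finite_external[OF gs] v by (simp add: card_Un_disjoint)
qed

section \<open>Course of the game under legal strategies\<close>

definition available :: "player \<Rightarrow> strategy \<Rightarrow> strategy \<Rightarrow> (node \<Rightarrow> nat) \<Rightarrow> nat \<Rightarrow> node set" where
  "available starter sM sB c n = (case position starter sM sB c n of (h, F, R) \<Rightarrow> external c F R)"

lemma mover_Suc: "mover starter (Suc n) = opponent (mover starter n)"
  by (cases starter) (auto simp: mover_def)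

lemma available_empty_mono:
  assumes "available starter sM sB c n = {}" "n \<le> m"
  shows "available starter sM sB c m = {}"
  using assms(2)
proof (induction m rule: dec_induct)
  case base
  then show ?case by (rule assms(1))
next
  case (step m)
  then show ?case by (auto simp: available_def split: prod.splits)
qed

context
  fixes starter :: player and sM sB :: strategy
  assumes legal: "legal_strategy sM" "legal_strategy sB"
begin

text \<open>Legality constrains a move by the most recent view, so the invariant must also record
  that the history starts with the current view.\<close>

lemma position_game_state:
  assumes "position starter sM sB c n = (h, F, R)"
  shows "game_state c F R \<and> (\<exists>h'. h = view_of c F R # h')"
  using assms
proof (induction n arbitrary: h F R)
  case 0
  then show ?case using game_state_initial by auto
next
  case (Suc n)
  obtain h0 F0 R0 where p: "position starter sM sB c n = (h0, F0, R0)"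
    by (cases "position starter sM sB c n") auto
  from Suc.IH[OF p] obtain h' where gs: "game_state c F0 R0" and h': "h0 = view_of c F0 R0 # h'"
    by auto
  show ?case
  proof (cases "external c F0 R0 = {}")
    case True
    then show ?thesis using Suc.prems p gs h' by auto
  next
    case False
    then have "sM h0 \<in> external c F0 R0" "sB h0 \<in> external c F0 R0"
      using legal unfolding h' view_of_def legal_strategy_def by auto
    then show ?thesis
      using Suc.prems p False game_state_remove[OF gs] game_state_fixate[OF gs]
      by (cases "mover starter n") (auto simp: Let_def)
  qed
qed

lemma moves_available:
  assumes "position starter sM sB c n = (h, F, R)" "external c F R \<noteq> {}"
  shows "sM h \<in> external c F R" "sB h \<in> external c F R"
proof -
  obtain h' where h: "h = (internal c F, external c F R) # h'"
    using position_game_state[OF assms(1)] by (auto simp: view_of_def)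
  show "sM h \<in> external c F R" "sB h \<in> external c F R"
    using legal assms(2) unfolding h legal_strategy_def by blast+
qed

lemma position_Suc_cases:
  assumes "position starter sM sB c n = (h, F, R)" "external c F R \<noteq> {}"
  obtains v where "mover starter n = Maker" "v \<in> external c F R" "v = sM h"
      "position starter sM sB c (Suc n) = (view_of c (insert v F) R # h, insert v F, R)"
    | r where "mover starter n = Breaker" "r \<in> external c F R" "r = sB h"
      "position starter sM sB c (Suc n) = (view_of c F (insert r R) # h, F, insert r R)"
  using that assms moves_available[OF assms] by (cases "mover starter n") (auto simp: Let_def)

lemma removed_edges_mono:
  assumes "n \<le> m"
  shows "removed_edges starter sM sB c n \<subseteq> removed_edges starter sM sB c m"
  using assms
proof (induction m rule: dec_induct)
  case base
  then show ?case by simp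
next
  case (step m)
  have "removed_edges starter sM sB c m \<subseteq> removed_edges starter sM sB c (Suc m)"
    by (auto simp: removed_edges_def Let_def split: prod.splits player.splits)
  then show ?case using step by blast
qed

text \<open>While the game goes on, Maker fixates a new edge every other turn. The extra 1 is for
  the turn in which Maker is due to move.\<close>

lemma fixated_edges_grow:
  assumes "\<And>n. available starter sM sB c n \<noteq> {}"
    and "position starter sM sB c n = (h, F, R)"
  shows "n \<le> 2 * card F + (if mover starter n = Maker then 1 else 0)"
  using assms(2)
proof (induction n arbitrary: h F R)
  case 0
  then show ?case by simp
next
  case (Suc n)
  obtain h0 F0 R0 where p: "position starter sM sB c n = (h0, F0, R0)"
    by (cases "position starter sM sB c n") auto
  have ne: "external c F0 R0 \<noteq> {}" using assms(1)[of n] p by (simp add: available_def)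
  note IH = Suc.IH[OF p]
  have gs: "game_state c F0 R0" using position_game_state[OF p] by simp
  from p ne show ?case
  proof (cases rule: position_Suc_cases)
    case (1 v)
    then have "v \<notin> F0" using gs by (auto simp: external_def game_state_def)
    moreover have "F = insert v F0" using 1(4) Suc.prems by (simp del: position.simps)
    ultimately have "card F = Suc (card F0)" using gs by (simp add: game_state_def)
    then show ?thesis using 1 IH by (simp add: mover_Suc)
  next
    case (2 r)
    then show ?thesis using IH Suc.prems by (simp add: mover_Suc)
  qed
qed

text \<open>When no edge is playable, every node of the root component is internal, and these are
  finitely many. Conversely, an endless game fixates arbitrarily many edges, and they all lie in the
  root component of any earlier position because removals only shrink that component.\<close>

lemma breaker_wins_iff: "breaker_wins starter sM sB c \<longleftrightarrow> (\<exists>n. available starter sM sB c n = {})"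
proof
  assume "\<exists>n. available starter sM sB c n = {}"
  then obtain n where n: "available starter sM sB c n = {}" by auto
  obtain h F R where p: "position starter sM sB c n = (h, F, R)"
    by (cases "position starter sM sB c n") auto
  have "w \<in> internal c F" if "w \<in> root_component c R" for w
    using that
  proof (induction w rule: rev_induct)
    case (snoc i u)
    then show ?case using n p by (auto simp: available_def external_def root_component_snoc)
  qed simp
  moreover have "finite (internal c F)"
    using position_game_state[OF p] by (simp add: game_state_def)
  ultimately have "finite (root_component c R)" by (meson finite_subset subsetI)
  then show "breaker_wins starter sM sB c"
    using p by (auto simp: breaker_wins_def removed_edges_def intro: exI[of _ n])
next
  assume "breaker_wins starter sM sB c"
  then obtain n where n: "finite (root_component c (removed_edges starter sM sB c n))"
    by (auto simp: breaker_wins_def)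
  show "\<exists>n. available starter sM sB c n = {}"
  proof (rule ccontr)
    assume "\<not> ?thesis"
    then have ne: "available starter sM sB c n \<noteq> {}" for n by blast
    \<comment> \<open>After \<open>m\<close> turns without an end at least
      \<open>(m - 1) / 2\<close> edges are fixated, which is more than the size of the
      component.\<close>
    define m where "m = n + 2 * card (root_component c (removed_edges starter sM sB c n)) + 2"
    obtain h F R where p: "position starter sM sB c m = (h, F, R)"
      by (cases "position starter sM sB c m") auto
    have gs: "game_state c F R" using position_game_state[OF p] by simp
    have "F \<subseteq> internal c F" using gs by (auto simp: game_state_def)
    also have "\<dots> \<subseteq> root_component c R"
      using gs by (intro internal_subset_root_component) (unfold game_state_def, blast)
    also have "\<dots> \<subseteq> root_component c (removed_edges starter sM sB c n)"
      using removed_edges_mono[of n m c] p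
      by (intro root_component_antimono) (simp add: m_def removed_edges_def)
    finally have "card F \<le> card (root_component c (removed_edges starter sM sB c n))"
      using n by (rule card_mono[rotated])
    moreover have "m \<le> 2 * card F + 1"
      using fixated_edges_grow[OF ne p] by (auto split: if_splits)
    ultimately show False by (simp add: m_def)
  qed
qed

text \<open>Expresses the absence of information: every tree that agrees with \<open>g\<close> at
  the root and the fixated nodes leads to the same position after \<open>n\<close> turns.\<close>

definition determined ::
  "nat \<Rightarrow> (node \<Rightarrow> nat) \<Rightarrow> view list \<Rightarrow> node set \<Rightarrow> node set \<Rightarrow> node set \<Rightarrow> bool" where
  "determined n g h F R E \<longleftrightarrow> (\<forall>c. (\<forall>v\<in>insert [] F. c v = g v) \<longrightarrow>
     position starter sM sB c n = (h, F, R) \<and> external c F R = E)"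

lemma determinedD:
  assumes "determined n g h F R E" "\<forall>v\<in>insert [] F. c v = g v"
  shows "position starter sM sB c n = (h, F, R)" "external c F R = E" "game_state c F R"
  using assms position_game_state[of c n h F R] by (auto simp: determined_def)

lemma determined_initial:
  "determined 0 (\<lambda>_. j) [({[]}, {[i] | i. i < j})] {} {} {[i] | i. i < j}"
  using game_state_initial
  by (auto simp: determined_def view_of_def external_initial game_state_def)

text \<open>A removal reveals no new node, so \<open>g\<close> stays the same.\<close>

lemma determined_Breaker:
  assumes "determined n g h F R E" "E \<noteq> {}" "mover starter n = Breaker"
  shows "\<exists>h' r. r \<in> E \<and> determined (Suc n) g h' F (insert r R) (E - {r})"
proof -
  have d: "position starter sM sB g n = (h, F, R)" "external g F R = E" "game_state g F R"
    by (rule determinedD[OF assms(1)]; simp)+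
  have "sB h \<in> E"
    using moves_available(2)[OF d(1)] d(2) assms(2) by simp
  moreover have "determined (Suc n) g ((insert [] F, E - {sB h}) # h) F (insert (sB h) R) (E - {sB h})"
    unfolding determined_def
  proof (intro allI impI)
    fix c assume "\<forall>v\<in>insert [] F. c v = g v"
    note c = determinedD[OF assms(1) this]
    have ne: "external c F R \<noteq> {}" using c assms(2) by simp
    from c(1) ne show "position starter sM sB c (Suc n) =
        ((insert [] F, E - {sB h}) # h, F, insert (sB h) R) \<and> external c F (insert (sB h) R) = E - {sB h}"
    proof (cases rule: position_Suc_cases)
      case (2 r)
      then show ?thesis
        using external_remove[OF c(3) 2(2)] c by (simp add: view_of_def game_state_def)
    qed (use assms in simp)
  qed
  ultimately show ?thesis by blast
qed

text \<open>The order of quantifiers matters: \<open>v\<close> is chosen from the history alone,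
  before its number of children \<open>j\<close> is revealed. Different \<open>j\<close> lead to
  different positions but share the same \<open>v\<close>.\<close>

lemma determined_Maker:
  assumes "determined n g h F R E" "E \<noteq> {}" "mover starter n = Maker"
  shows "\<exists>v. v \<in> E \<and> v \<notin> insert [] F \<and> (\<forall>j. \<exists>h' E'. card E' = card E - 1 + j \<and>
    determined (Suc n) (g(v := j)) h' (insert v F) R E')"
proof (intro exI[of _ "sM h"] conjI allI)
  let ?v = "sM h"
  have d: "position starter sM sB g n = (h, F, R)" "external g F R = E" "game_state g F R"
    by (rule determinedD[OF assms(1)]; simp)+
  show v: "?v \<in> E"
    using moves_available(1)[OF d(1)] d(2) assms(2) by simp
  then show v_new: "?v \<notin> insert [] F"
    using d by (auto simp: external_def game_state_def)
  fix j
  let ?E = "(E - {?v}) \<union> {?v @ [i] | i. i < j}"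
  have step: "position starter sM sB c (Suc n) =
        ((insert ?v (insert [] F), ?E) # h, insert ?v F, R) \<and> external c (insert ?v F) R = ?E \<and>
        card ?E = card E - 1 + j"
    if "\<forall>v\<in>insert [] (insert ?v F). c v = (g(?v := j)) v" for c
  proof -
    have agree: "\<forall>w\<in>insert [] F. c w = g w"
    proof
      fix w assume w: "w \<in> insert [] F"
      then have "w \<noteq> ?v" using v_new by blast
      then show "c w = g w" using that w by (simp only: fun_upd_apply if_False insert_iff simp_thms ball_simps)
    qed
    have cv: "c ?v = j" using that by simp
    note c = determinedD[OF assms(1) agree] cv
    have ne: "external c F R \<noteq> {}" using c assms(2) by simp
    from c(1) ne show ?thesis
    proof (cases rule: position_Suc_cases)
      case (1 v)
      then show ?thesis
        using external_fixate[OF c(3) 1(2)] card_external_fixate[OF c(3) 1(2)]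
          game_state_fixate[OF c(3) 1(2)] c
        by (simp add: view_of_def game_state_def insert_commute)
    qed (use assms in simp)
  qed
  then have "determined (Suc n) (g(?v := j)) ((insert ?v (insert [] F), ?E) # h) (insert ?v F) R ?E"
    unfolding determined_def by blast
  moreover have "card ?E = card E - 1 + j" using step[of "g(?v := j)"] by blast
  ultimately show "\<exists>h' E'. card E' = card E - 1 + j \<and>
      determined (Suc n) (g(?v := j)) h' (insert ?v F) R E'" by blast
qed

end

section \<open>The game on a Galton-Watson tree\<close>

text \<open>
  \<open>win_prob \<xi> n p k\<close> is the probability that the available edges run out within \<open>n\<close> turns if
  player \<open>p\<close> moves next and \<open>k\<close> edges are available.
\<close>

fun win_prob :: "nat pmf \<Rightarrow> nat \<Rightarrow> player \<Rightarrow> nat \<Rightarrow> ennreal" where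
  "win_prob \<xi> n p 0 = 1"
| "win_prob \<xi> 0 p (Suc k) = 0"
| "win_prob \<xi> (Suc n) Breaker (Suc k) = win_prob \<xi> n Maker k"
| "win_prob \<xi> (Suc n) Maker (Suc k) = (\<integral>\<^sup>+j. win_prob \<xi> n Breaker (k + j) \<partial>measure_pmf \<xi>)"

locale galton_watson_game = prob_space M
  for M :: "'a measure" and children :: "node \<Rightarrow> 'a \<Rightarrow> nat" and \<xi> :: "nat pmf"
    and starter :: player and sM sB :: strategy +
  assumes iid: "iid_with_law M children \<xi>"
    and legal: "legal_strategy sM" "legal_strategy sB"
begin

lemma measurable_children [measurable]: "children v \<in> measurable M (count_space UNIV)"
  using iid by (simp add: iid_with_law_def indep_vars_def)

definition cylinder :: "node set \<Rightarrow> (node \<Rightarrow> nat) \<Rightarrow> 'a set" where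
  "cylinder D g = {\<omega> \<in> space M. \<forall>v\<in>D. children v \<omega> = g v}"

lemma cylinder_event: "finite D \<Longrightarrow> cylinder D g \<in> events"
  unfolding cylinder_def by measurable

lemma emeasure_cylinder:
  assumes "finite D"
  shows "emeasure M (cylinder D g) = (\<Prod>v\<in>D. ennreal (pmf \<xi> (g v)))"
\<comment> \<open>For empty \<open>D\<close> the cylinder is all of \<open>space M\<close>, which is
  not an intersection over the empty index set.\<close>
proof (cases "D = {}")
  case True
  then show ?thesis by (simp add: cylinder_def emeasure_space_1)
next
  case False
  have "prob (children v -` {j} \<inter> space M) = pmf \<xi> j" for v j
  proof -
    have "pmf \<xi> j = measure (distr M (count_space UNIV) (children v)) {j}"
      using iid by (simp add: iid_with_law_def measure_pmf_single)
    then show ?thesis by (simp add: measure_distr)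
  qed
  moreover have "cylinder D g = (\<Inter>v\<in>D. children v -` {g v} \<inter> space M)"
    using False by (auto simp: cylinder_def)
  moreover have "prob (\<Inter>v\<in>D. children v -` {g v} \<inter> space M) =
      (\<Prod>v\<in>D. prob (children v -` {g v} \<inter> space M))"
    using iid False assms by (intro indep_varsD[where I=UNIV]) (auto simp: iid_with_law_def)
  ultimately show ?thesis
    by (simp add: emeasure_eq_measure prod_ennreal pmf_nonneg)
qed

abbreviation exhausted :: "nat \<Rightarrow> 'a \<Rightarrow> bool" where
  "exhausted n \<omega> \<equiv> available starter sM sB (\<lambda>v. children v \<omega>) n = {}"

text \<open>
  Conditioning on a cylinder over the internal nodes fixes the position; the external node chosen by
  Maker lies outside this cylinder, so its number of children still has law \<open>\<xi>\<close>.
\<close>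

lemma emeasure_exhausted_determined:
  assumes "determined starter sM sB n g h F R E" "finite F" "finite E"
  shows "{\<omega>. exhausted (n + m) \<omega>} \<inter> cylinder (insert [] F) g \<in> events \<and>
    emeasure M ({\<omega>. exhausted (n + m) \<omega>} \<inter> cylinder (insert [] F) g) =
      (\<Prod>v\<in>insert [] F. ennreal (pmf \<xi> (g v))) * win_prob \<xi> m (mover starter n) (card E)"
  using assms
proof (induction m arbitrary: n g h F R E)
  case 0
  have now: "available starter sM sB (\<lambda>v. children v \<omega>) n = E"
    if "\<omega> \<in> cylinder (insert [] F) g" for \<omega>
    using determinedD[OF legal 0(1), of "\<lambda>v. children v \<omega>"] that
    by (simp add: available_def cylinder_def)
  show ?case
  proof (cases "E = {}")
    case True
    then have "{\<omega>. exhausted (n + 0) \<omega>} \<inter> cylinder (insert [] F) g = cylinder (insert [] F) g"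
      using now by auto
    then show ?thesis using True 0 by (simp add: emeasure_cylinder cylinder_event del: prod.insert)
  next
    case False
    then have empty: "{\<omega>. exhausted (n + 0) \<omega>} \<inter> cylinder (insert [] F) g = {}"
      using now by auto
    obtain k where "card E = Suc k" using False 0 by (cases "card E") auto
    then show ?thesis unfolding empty by simp
  qed
next
  case (Suc m)
  have now: "available starter sM sB (\<lambda>v. children v \<omega>) n = E"
    if "\<omega> \<in> cylinder (insert [] F) g" for \<omega>
    using determinedD[OF legal Suc.prems(1), of "\<lambda>v. children v \<omega>"] that
    by (simp add: available_def cylinder_def)
  show ?case
  proof (cases "E = {}")
    case True
    have "exhausted (n + Suc m) \<omega>" if "\<omega> \<in> cylinder (insert [] F) g" for \<omega>
      by (rule available_empty_mono[of _ _ _ _ n]) (simp_all add: now[OF that] True)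
    then have "{\<omega>. exhausted (n + Suc m) \<omega>} \<inter> cylinder (insert [] F) g = cylinder (insert [] F) g"
      by blast
    then show ?thesis using True Suc.prems by (simp add: emeasure_cylinder cylinder_event del: prod.insert)
  next
    case E: False
    obtain k where k: "card E = Suc k" using E Suc.prems by (cases "card E") auto
    show ?thesis
    proof (cases "mover starter n")
      case Breaker
      from determined_Breaker[OF legal Suc.prems(1) E Breaker] obtain h' r
        where r: "r \<in> E" and d: "determined starter sM sB (Suc n) g h' F (insert r R) (E - {r})"
        by blast
      have "card (E - {r}) = k" using r k Suc.prems by simp
      then show ?thesis
        using Suc.IH[OF d] Suc.prems by (simp add: k Breaker mover_Suc)
    next
      case Maker
      from determined_Maker[OF legal Suc.prems(1) E Maker] obtain v
        where v: "v \<in> E" "v \<notin> insert [] F" and ex: "\<forall>j. \<exists>h' E'. card E' = card E - 1 + j \<and>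
          determined starter sM sB (Suc n) (g(v := j)) h' (insert v F) R E'"
        by blast
      \<comment> \<open>The part of the event in which the node fixated by Maker turns out to have
        \<open>j\<close> children.\<close>
      define A where
        "A j = {\<omega>. exhausted (Suc n + m) \<omega>} \<inter> cylinder (insert [] (insert v F)) (g(v := j))" for j
      define c where "c = (\<Prod>u\<in>insert [] F. ennreal (pmf \<xi> (g u)))"
      have A: "A j \<in> events"
        "emeasure M (A j) = ennreal (pmf \<xi> j) * c * win_prob \<xi> m Breaker (k + j)" for j
      proof -
        obtain h' E' where E': "card E' = card E - 1 + j"
          and d: "determined starter sM sB (Suc n) (g(v := j)) h' (insert v F) R E'"
          using ex by blast
        have "E' = external (g(v := j)) (insert v F) R" "game_state (g(v := j)) (insert v F) R"
          using determinedD(2,3)[OF legal d, of "g(v := j)"] by auto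
        then have "finite E'" using finite_external by blast
        note IH = Suc.IH[OF d _ this]
        \<comment> \<open>As \<open>v\<close> lies outside the old cylinder, it contributes one
          separate factor \<open>pmf \<xi> j\<close>, and the others are unaffected by the update of
          \<open>g\<close>.\<close>
        have "(\<Prod>u\<in>insert [] (insert v F). ennreal (pmf \<xi> ((g(v := j)) u))) = ennreal (pmf \<xi> j) * c"
        proof -
          have "(\<Prod>u\<in>insert v (insert [] F). ennreal (pmf \<xi> ((g(v := j)) u))) =
              ennreal (pmf \<xi> j) * (\<Prod>u\<in>insert [] F. ennreal (pmf \<xi> ((g(v := j)) u)))"
            using v Suc.prems by (subst prod.insert) auto
          also have "(\<Prod>u\<in>insert [] F. ennreal (pmf \<xi> ((g(v := j)) u))) = c"
            unfolding c_def using v by (intro prod.cong) auto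
          finally show ?thesis by (simp add: insert_commute)
        qed
        then show "A j \<in> events"
          "emeasure M (A j) = ennreal (pmf \<xi> j) * c * win_prob \<xi> m Breaker (k + j)"
          using IH Suc.prems(2) unfolding A_def by (simp_all add: E' k Maker mover_Suc del: fun_upd_apply)
      qed
      \<comment> \<open>The number of children of \<open>v\<close> takes exactly one value, so it
        partitions the old cylinder.\<close>
      have union: "{\<omega>. exhausted (n + Suc m) \<omega>} \<inter> cylinder (insert [] F) g = (\<Union>j. A j)"
        using v unfolding A_def cylinder_def by auto
      have "disjoint_family A"
        using v by (auto simp: disjoint_family_on_def A_def cylinder_def)
      then have "emeasure M (\<Union>j. A j) = (\<integral>\<^sup>+j. emeasure M (A j) \<partial>count_space UNIV)"
        using A by (intro emeasure_UN_countable) auto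
      also have "\<dots> = (\<integral>\<^sup>+j. c * (ennreal (pmf \<xi> j) * win_prob \<xi> m Breaker (k + j)) \<partial>count_space UNIV)"
        by (simp add: A mult_ac)
      also have "\<dots> = c * win_prob \<xi> (Suc m) Maker (Suc k)"
        by (simp add: nn_integral_cmult nn_integral_measure_pmf)
      finally show ?thesis
        unfolding union using A by (simp add: c_def k Maker)
    qed
  qed
qed

text \<open>At the start only the root is internal, so the event is split by the number of children
  of the root.\<close>

lemma emeasure_exhausted:
  shows "{\<omega> \<in> space M. exhausted n \<omega>} \<in> events"
    and "emeasure M {\<omega> \<in> space M. exhausted n \<omega>} =
      (\<integral>\<^sup>+j. win_prob \<xi> n starter j \<partial>measure_pmf \<xi>)"
proof -
  define A where "A j = {\<omega>. exhausted n \<omega>} \<inter> cylinder {[]} (\<lambda>_. j)" for j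
  have A: "A j \<in> events" "emeasure M (A j) = ennreal (pmf \<xi> j) * win_prob \<xi> n starter j" for j
  proof -
    have d: "determined starter sM sB 0 (\<lambda>_. j) [({[]}, {[i] | i. i < j})] {} {} {[i] | i. i < j}"
      by (rule determined_initial[OF legal])
    have "card ((\<lambda>i. [i]) ` {..<j} :: node set) = j" by (simp add: card_image inj_on_def)
    moreover have "{[i] | i. i < j} = (\<lambda>i. [i]) ` {..<j}" by auto
    ultimately show "A j \<in> events" "emeasure M (A j) = ennreal (pmf \<xi> j) * win_prob \<xi> n starter j"
      using emeasure_exhausted_determined[OF d, of n]
      unfolding A_def by (simp_all add: mover_def)
  qed
  have union: "{\<omega> \<in> space M. exhausted n \<omega>} = (\<Union>j. A j)"
    by (auto simp: A_def cylinder_def)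
  show "{\<omega> \<in> space M. exhausted n \<omega>} \<in> events"
    unfolding union using A by auto
  have "disjoint_family A" by (auto simp: disjoint_family_on_def A_def cylinder_def)
  then have "emeasure M (\<Union>j. A j) = (\<integral>\<^sup>+j. emeasure M (A j) \<partial>count_space UNIV)"
    using A by (intro emeasure_UN_countable) auto
  then show "emeasure M {\<omega> \<in> space M. exhausted n \<omega>} =
      (\<integral>\<^sup>+j. win_prob \<xi> n starter j \<partial>measure_pmf \<xi>)"
    unfolding union by (simp add: A nn_integral_measure_pmf)
qed

text \<open>Exhaustion is permanent, so the events increase and any subsequence of turn numbers will
  do. This permits a choice of parity such that whole rounds correspond to steps of the embedded
  walk.\<close>

lemma emeasure_breaker_wins:
  fixes r :: "nat \<Rightarrow> nat"
  assumes "strict_mono r"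
  shows "emeasure M {\<omega> \<in> space M. breaker_wins starter sM sB (\<lambda>v. children v \<omega>)} =
    (SUP n. \<integral>\<^sup>+j. win_prob \<xi> (r n) starter j \<partial>measure_pmf \<xi>)"
proof -
  have "{\<omega> \<in> space M. breaker_wins starter sM sB (\<lambda>v. children v \<omega>)} =
      (\<Union>n. {\<omega> \<in> space M. exhausted (r n) \<omega>})"
  proof -
    have "exhausted (r n) \<omega>" if "exhausted n \<omega>" for n \<omega>
      using that seq_suble[OF assms] by (rule available_empty_mono)
    then show ?thesis by (auto simp: breaker_wins_iff[OF legal])
  qed
  moreover have "incseq (\<lambda>n. {\<omega> \<in> space M. exhausted (r n) \<omega>})"
    using available_empty_mono[of starter sM sB] strict_mono_leD[OF assms]
    unfolding incseq_def by blast
  ultimately show ?thesis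
    using SUP_emeasure_incseq[of "\<lambda>n. {\<omega> \<in> space M. exhausted (r n) \<omega>}" M] emeasure_exhausted
    by (auto simp: image_subset_iff)
qed

end

section \<open>The embedded walk\<close>

text \<open>Finite-horizon form of \<open>down_at_parity\<close> for even times:
  \<open>k + partial_sum s (2 * n)\<close> plays the role of the embedded walk at time
  \<open>n\<close>, started at \<open>k\<close>. The height is an integer because a round can take
  it below 0.\<close>

definition down_by :: "nat \<Rightarrow> int \<Rightarrow> int stream \<Rightarrow> bool" where
  "down_by m k s \<longleftrightarrow> (\<exists>n\<le>m. k + partial_sum s (2 * n) \<le> 0)"

lemma measurable_down_by [measurable]: "Measurable.pred (iid_stream Q) (down_by m k)"
proof -
  have [measurable]: "Measurable.pred (iid_stream Q) (\<lambda>s. k + partial_sum s n \<le> 0)" for n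
    by (rule measurable_compose[OF measurable_partial_sum]) simp
  show ?thesis unfolding down_by_def[abs_def] by measurable
qed

lemma down_by_Suc_iff:
  "down_by (Suc m) k (x ## y ## s) \<longleftrightarrow> k \<le> 0 \<or> down_by m (k + x + y) s"
proof -
  have "down_by (Suc m) k t \<longleftrightarrow> k \<le> 0 \<or> (\<exists>n\<le>m. k + partial_sum t (2 * Suc n) \<le> 0)" for t
    unfolding down_by_def by (metis Suc_le_mono add_0_right le0 mult_0_right not0_implies_Suc partial_sum_0)
  then show ?thesis by (simp add: down_by_def add.assoc)
qed

lemma down_by_nonpos: "k \<le> 0 \<Longrightarrow> down_by m k s"
  by (auto simp: down_by_def intro!: exI[of _ 0])

lemma emeasure_down_by_Suc:
  assumes "k > 0"
  shows "emeasure (iid_stream Q) {s. down_by (Suc m) k s} =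
    (\<integral>\<^sup>+x. \<integral>\<^sup>+y. emeasure (iid_stream Q) {s. down_by m (k + x + y) s} \<partial>measure_pmf Q \<partial>measure_pmf Q)"
proof -
  note step = prob_space.emeasure_stream_space[OF measure_pmf.prob_space_axioms sets_iid_stream_Collect]
  have "emeasure (iid_stream Q) {s. down_by (Suc m) k s} =
      (\<integral>\<^sup>+x. emeasure (iid_stream Q) {s. down_by (Suc m) k (x ## s)} \<partial>measure_pmf Q)"
    by (subst step) simp_all
  also have "\<dots> = (\<integral>\<^sup>+x. \<integral>\<^sup>+y. emeasure (iid_stream Q) {s. down_by (Suc m) k (x ## y ## s)}
      \<partial>measure_pmf Q \<partial>measure_pmf Q)"
    by (subst step) simp_all
  finally show ?thesis using assms by (simp add: down_by_Suc_iff)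
qed

lemma emeasure_down_by_nonpos:
  "k \<le> 0 \<Longrightarrow> emeasure (iid_stream Q) {s. down_by m k s} = 1"
  using prob_space.emeasure_space_1[OF prob_space_iid_stream] by (simp add: down_by_nonpos)

lemma SUP_emeasure_down_by:
  "(SUP m. emeasure (iid_stream Q) {s. down_by (Suc m) (int k) s}) =
     emeasure (iid_stream Q) {s. down_at_parity k True s}"
proof -
  have "{s. down_at_parity k True s} = (\<Union>m. {s. down_by (Suc m) (int k) s})"
  proof safe
    fix s assume "down_at_parity k True s"
    then obtain n where "int k + partial_sum s (2 * n) \<le> 0"
      by (auto simp: down_at_parity_def elim!: evenE)
    then have "down_by (Suc n) (int k) s" by (auto simp: down_by_def intro: le_SucI)
    then show "s \<in> (\<Union>m. {s. down_by (Suc m) (int k) s})" by blast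
  next
    fix s m assume "down_by (Suc m) (int k) s"
    then obtain n where "int k + partial_sum s (2 * n) \<le> 0" by (auto simp: down_by_def)
    then show "down_at_parity k True s"
      unfolding down_at_parity_def by (intro exI[of _ "2 * n"]) simp
  qed
  moreover have "incseq (\<lambda>m. {s. down_by (Suc m) (int k) s})"
    unfolding incseq_def down_by_def by (blast intro: le_trans)
  moreover have "range (\<lambda>m. {s. down_by (Suc m) (int k) s}) \<subseteq> sets (iid_stream Q)"
    using sets_iid_stream_Collect[OF measurable_down_by] by blast
  ultimately show ?thesis
    by (simp only: SUP_emeasure_incseq)
qed

section \<open>Separable offspring laws and the winning probabilities\<close>

context
  fixes \<xi> :: "nat pmf" and X :: "int pmf"
  assumes separable: "map_pmf int \<xi> = map_pmf (\<lambda>(x1, x2). x1 + x2) (pair_pmf X X)"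
begin

abbreviation step_law :: "int pmf" where
  "step_law \<equiv> map_pmf (\<lambda>x. x - 1) X"

lemma nn_integral_separable:
  "(\<integral>\<^sup>+j. f (int j) \<partial>measure_pmf \<xi>) = (\<integral>\<^sup>+x. \<integral>\<^sup>+y. f (x + y) \<partial>measure_pmf X \<partial>measure_pmf X)"
proof -
  have "(\<integral>\<^sup>+j. f (int j) \<partial>measure_pmf \<xi>) = (\<integral>\<^sup>+i. f i \<partial>measure_pmf (map_pmf int \<xi>))" by simp
  also have "\<dots> = (\<integral>\<^sup>+x. \<integral>\<^sup>+y. f (x + y) \<partial>measure_pmf X \<partial>measure_pmf X)"
    by (simp add: separable nn_integral_pair_pmf')
  finally show ?thesis .
qed

text \<open>By separability, two consecutive steps, each distributed as a summand minus 1, together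
  have the law of \<open>\<xi>\<close> minus 2.\<close>

lemma emeasure_down_by_Suc_separable:
  assumes "k > 0"
  shows "emeasure (iid_stream step_law) {s. down_by (Suc m) k s} =
    (\<integral>\<^sup>+j. emeasure (iid_stream step_law) {s. down_by m (k + int j - 2) s} \<partial>measure_pmf \<xi>)"
  unfolding emeasure_down_by_Suc[OF assms]
    nn_integral_separable[of "\<lambda>i. emeasure (iid_stream step_law) {s. down_by m (k + i - 2) s}"]
  by (simp add: algebra_simps)

text \<open>A round consisting of a Maker turn and a Breaker turn uses up two edges and adds the
  children of the fixated node, just as a double step of the walk adds a copy of
  \<open>\<xi>\<close> minus 2.\<close>

lemma win_prob_eq_down_by:
  "win_prob \<xi> (2 * m) Maker k = emeasure (iid_stream step_law) {s. down_by m (int k) s}"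
proof (induction m arbitrary: k)
  case 0
  then show ?case
  proof (cases k)
    case 0
    then show ?thesis by (simp add: emeasure_down_by_nonpos)
  next
    case (Suc k')
    then show ?thesis by (simp add: down_by_def)
  qed
next
  case (Suc m)
  show ?case
  proof (cases k)
    case 0
    then show ?thesis by (simp add: emeasure_down_by_nonpos)
  next
    case (Suc k')
    \<comment> \<open>If Maker's turn leaves no edge, the game is over although Breaker has not
      moved; the walk is then at -1 and counts as down as well, so both sides are 1.\<close>
    have "win_prob \<xi> (Suc (2 * m)) Breaker i =
        emeasure (iid_stream step_law) {s. down_by m (int i - 1) s}" for i
      by (cases i) (simp_all add: Suc.IH emeasure_down_by_nonpos)
    then show ?thesis
      by (simp add: Suc emeasure_down_by_Suc_separable algebra_simps)
  qed
qed

text \<open>The children of the root serve as the first step of the embedded walk. Maker's first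
  turn finds \<open>\<xi>\<close> edges if Maker starts and \<open>\<xi>\<close> minus 1 if Breaker
  starts, that is, 2 or 1 plus an increment \<open>\<xi>\<close> minus 2. This explains the start at
  2 or 1 and the horizon \<open>Suc m\<close>.\<close>

lemma emeasure_breaker_wins_walk:
  assumes "prob_space M" "iid_with_law M children \<xi>" "legal_strategy sM" "legal_strategy sB"
  shows "emeasure M {\<omega> \<in> space M. breaker_wins Breaker sM sB (\<lambda>v. children v \<omega>)} =
      emeasure (iid_stream step_law) {s. down_at_parity 1 True s}"
    and "emeasure M {\<omega> \<in> space M. breaker_wins Maker sM sB (\<lambda>v. children v \<omega>)} =
      emeasure (iid_stream step_law) {s. down_at_parity 2 True s}"
proof -
  interpret prob_space M by fact
  have game: "galton_watson_game M children \<xi> sM sB"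
    by unfold_locales (use assms in auto)
  \<comment> \<open>The number of turns is odd here: Breaker's opening removal followed by
    \<open>m\<close> whole rounds.\<close>
  have B: "win_prob \<xi> (Suc (2 * m)) Breaker i =
      emeasure (iid_stream step_law) {s. down_by m (int i - 1) s}" for i m
    by (cases i) (simp_all add: win_prob_eq_down_by emeasure_down_by_nonpos)
  have "emeasure M {\<omega> \<in> space M. breaker_wins Breaker sM sB (\<lambda>v. children v \<omega>)} =
      (SUP m. \<integral>\<^sup>+j. win_prob \<xi> (Suc (2 * m)) Breaker j \<partial>measure_pmf \<xi>)"
    by (rule galton_watson_game.emeasure_breaker_wins[OF game]) (simp add: strict_mono_def)
  also have "\<dots> = (SUP m. emeasure (iid_stream step_law) {s. down_by (Suc m) (int 1) s})"
  proof (intro SUP_cong refl)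
    fix m
    have "(\<integral>\<^sup>+j. win_prob \<xi> (Suc (2 * m)) Breaker j \<partial>measure_pmf \<xi>) =
        (\<integral>\<^sup>+j. emeasure (iid_stream step_law) {s. down_by m (int 1 + int j - 2) s} \<partial>measure_pmf \<xi>)"
      by (intro nn_integral_cong) (simp only: B of_nat_1 add_diff_eq, simp)
    then show "(\<integral>\<^sup>+j. win_prob \<xi> (Suc (2 * m)) Breaker j \<partial>measure_pmf \<xi>) =
        emeasure (iid_stream step_law) {s. down_by (Suc m) (int 1) s}"
      by (subst emeasure_down_by_Suc_separable) simp_all
  qed
  finally show "emeasure M {\<omega> \<in> space M. breaker_wins Breaker sM sB (\<lambda>v. children v \<omega>)} =
      emeasure (iid_stream step_law) {s. down_at_parity 1 True s}"
    unfolding SUP_emeasure_down_by .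
  have "emeasure M {\<omega> \<in> space M. breaker_wins Maker sM sB (\<lambda>v. children v \<omega>)} =
      (SUP m. \<integral>\<^sup>+j. win_prob \<xi> (2 * m) Maker j \<partial>measure_pmf \<xi>)"
    by (rule galton_watson_game.emeasure_breaker_wins[OF game]) (simp add: strict_mono_def)
  also have "\<dots> = (SUP m. emeasure (iid_stream step_law) {s. down_by (Suc m) (int 2) s})"
  proof (intro SUP_cong refl)
    fix m
    have "(\<integral>\<^sup>+j. win_prob \<xi> (2 * m) Maker j \<partial>measure_pmf \<xi>) =
        (\<integral>\<^sup>+j. emeasure (iid_stream step_law) {s. down_by m (int 2 + int j - 2) s} \<partial>measure_pmf \<xi>)"
      by (intro nn_integral_cong) (simp add: win_prob_eq_down_by)
    then show "(\<integral>\<^sup>+j. win_prob \<xi> (2 * m) Maker j \<partial>measure_pmf \<xi>) =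
        emeasure (iid_stream step_law) {s. down_by (Suc m) (int 2) s}"
      by (subst emeasure_down_by_Suc_separable) simp_all
  qed
  finally show "emeasure M {\<omega> \<in> space M. breaker_wins Maker sM sB (\<lambda>v. children v \<omega>)} =
      emeasure (iid_stream step_law) {s. down_at_parity 2 True s}"
    unfolding SUP_emeasure_down_by .
qed

text \<open>By independence the support of the sum contains \<open>x + x\<close> for every
  \<open>x\<close> in the support of \<open>X\<close>, so \<open>x\<close> cannot be negative. Hence
  the steps of the walk are at least -1.\<close>

lemma separable_nonneg: "set_pmf X \<subseteq> {0..}"
proof
  fix x assume "x \<in> set_pmf X"
  then have "x + x \<in> set_pmf (map_pmf (\<lambda>(x1, x2). x1 + x2) (pair_pmf X X))" by force
  then have "x + x \<in> set_pmf (map_pmf int \<xi>)" by (simp only: separable)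
  then show "x \<in> {0..}" by auto
qed

text \<open>Two nonnegative summands add up to 0 only if both are 0. Hence the walk takes the step
  -1 with positive probability.\<close>

lemma separable_zero:
  assumes "pmf \<xi> 0 > 0"
  shows "pmf X 0 > 0"
proof -
  have "0 \<in> set_pmf (map_pmf int \<xi>)" using assms by (force simp: set_pmf_iff)
  then obtain x y where "x \<in> set_pmf X" "y \<in> set_pmf X" "x + y = 0" by (auto simp: separable)
  moreover from this have "x \<ge> 0" "y \<ge> 0" using separable_nonneg by auto
  ultimately have "0 \<in> set_pmf X" by (simp add: add_nonneg_eq_0_iff)
  then show ?thesis by (simp add: pmf_positive)
qed

end

section \<open>Transfer from random streams to the given walk\<close>

lemma walk_eq_partial_sum: "walk Y \<omega> = partial_sum (to_stream (\<lambda>i. Y i \<omega>))"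
proof
  fix n show "walk Y \<omega> n = partial_sum (to_stream (\<lambda>i. Y i \<omega>)) n"
    by (induction n) (simp_all add: walk_def partial_sum_Suc to_stream_def)
qed

text \<open>Independence makes the joint law of the increments a product measure, and the stream
  measure is by construction the image of that product under \<open>to_stream\<close>.\<close>

lemma distr_to_stream_iid:
  assumes "prob_space N" and iid: "iid_with_law N Y Q"
  shows "(\<lambda>\<omega>. to_stream (\<lambda>i. Y i \<omega>)) \<in> measurable N (iid_stream Q)"
    and "distr N (iid_stream Q) (\<lambda>\<omega>. to_stream (\<lambda>i. Y i \<omega>)) = iid_stream Q"
proof -
  interpret prob_space N by fact
  have rv [measurable]: "Y i \<in> measurable N (count_space UNIV)" for i
    using iid by (simp add: iid_with_law_def indep_vars_def)
  have sets: "sets (PiM UNIV (\<lambda>_. count_space UNIV)) = sets (PiM UNIV (\<lambda>_::nat. measure_pmf Q))"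
    by (rule sets_PiM_cong) simp_all
  have Y: "(\<lambda>\<omega> i. Y i \<omega>) \<in> measurable N (PiM UNIV (\<lambda>_. count_space UNIV))"
    by (rule measurable_PiM_single') (auto simp: rv)
  then have Y': "(\<lambda>\<omega> i. Y i \<omega>) \<in> measurable N (PiM UNIV (\<lambda>_. measure_pmf Q))"
    using measurable_cong_sets[OF refl sets] by blast
  then show "(\<lambda>\<omega>. to_stream (\<lambda>i. Y i \<omega>)) \<in> measurable N (iid_stream Q)"
    by (rule measurable_compose) (rule measurable_to_stream)
  have "distr N (PiM UNIV (\<lambda>_. measure_pmf Q)) (\<lambda>\<omega> i. Y i \<omega>) =
      distr N (PiM UNIV (\<lambda>_. count_space UNIV)) (\<lambda>\<omega>. \<lambda>i\<in>UNIV. Y i \<omega>)"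
    by (rule distr_cong) (simp_all add: sets restrict_def)
  also have "\<dots> = PiM UNIV (\<lambda>i. distr N (count_space UNIV) (Y i))"
    using iid indep_vars_iff_distr_eq_PiM[where I = UNIV and M' = "\<lambda>_. count_space UNIV" and X = Y]
    by (simp add: iid_with_law_def)
  also have "\<dots> = PiM UNIV (\<lambda>_. measure_pmf Q)"
    using iid by (simp add: iid_with_law_def)
  finally have "distr N (PiM UNIV (\<lambda>_. measure_pmf Q)) (\<lambda>\<omega> i. Y i \<omega>) = PiM UNIV (\<lambda>_. measure_pmf Q)" .
  then have "iid_stream Q =
      distr (distr N (PiM UNIV (\<lambda>_. measure_pmf Q)) (\<lambda>\<omega> i. Y i \<omega>)) (iid_stream Q) to_stream"
    using stream_space_eq_distr[of "measure_pmf Q"] by simp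
  also have "\<dots> = distr N (iid_stream Q) (to_stream \<circ> (\<lambda>\<omega> i. Y i \<omega>))"
    by (rule distr_distr[OF measurable_to_stream Y'])
  finally show "distr N (iid_stream Q) (\<lambda>\<omega>. to_stream (\<lambda>i. Y i \<omega>)) = iid_stream Q"
    by (simp add: comp_def)
qed

text \<open>\<open>P\<close> is the event in terms of the stopping times and \<open>R\<close> its
  reformulation for streams. Agreement almost everywhere is enough, as the reformulations for
  returns rely on steps of at least -1.\<close>

lemma prob_walk_eq:
  assumes N: "prob_space N" "iid_with_law N Y Q"
    and P: "Measurable.pred (iid_stream Q) (\<lambda>s. P (partial_sum s))"
    and R: "Measurable.pred (iid_stream Q) R"
    and AE: "AE s in iid_stream Q. P (partial_sum s) \<longleftrightarrow> R s"
  shows "\<P>(\<omega> in N. P (walk Y \<omega>)) = measure (iid_stream Q) {s. R s}"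
proof -
  note T = distr_to_stream_iid[OF N]
  interpret S: prob_space "iid_stream Q" by (rule prob_space_iid_stream)
  have "measure (iid_stream Q) {s. R s} = measure (iid_stream Q) {s. P (partial_sum s)}"
    using AE by (intro S.finite_measure_eq_AE sets_iid_stream_Collect P R) auto
  also have "\<dots> = measure (distr N (iid_stream Q) (\<lambda>\<omega>. to_stream (\<lambda>i. Y i \<omega>))) {s. P (partial_sum s)}"
    by (simp only: T(2))
  also have "\<dots> = \<P>(\<omega> in N. P (walk Y \<omega>))"
    by (subst measure_distr[OF T(1) sets_iid_stream_Collect[OF P]])
      (simp add: walk_eq_partial_sum vimage_def Int_def conj_commute)
  finally show ?thesis ..
qed

theorem theorem5p5:
  fixes \<xi> :: "nat pmf" and X :: "int pmf"
    and M :: "'a measure" and children :: "node \<Rightarrow> 'a \<Rightarrow> nat"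
    and sM sB :: strategy
    and N :: "'b measure" and Y :: "nat \<Rightarrow> 'b \<Rightarrow> int"
    and \<rho> \<sigma> \<theta> \<rho>_odd \<theta>_odd :: real
  assumes "pmf \<xi> 0 > 0"
    and "(\<integral>\<^sup>+ k. of_nat k \<partial>measure_pmf \<xi>) > 2"
    and separable: "map_pmf int \<xi> = map_pmf (\<lambda>(x1, x2). x1 + x2) (pair_pmf X X)"
    and "prob_space M" and galton_watson: "iid_with_law M children \<xi>"
    and "legal_strategy sM" and "legal_strategy sB"
    and "prob_space N" and increments: "iid_with_law N Y (map_pmf (\<lambda>x. x - 1) X)"
    and "\<rho> = \<P>(\<omega> in N. tau_minus1 (walk Y \<omega>) < \<infinity>)"
    and "\<sigma> = \<P>(\<omega> in N. \<forall>n\<ge>1. walk Y \<omega> n > 0)"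
    and "\<theta> = \<P>(\<omega> in N. tau_0_plus (walk Y \<omega>) < tau_minus1 (walk Y \<omega>))"
    and "\<rho>_odd = \<P>(\<omega> in N. odd_time (tau_minus1 (walk Y \<omega>)) \<bar> tau_minus1 (walk Y \<omega>) < \<infinity>)"
    and "\<theta>_odd = \<P>(\<omega> in N. odd_time (tau_0_plus (walk Y \<omega>))
                     \<bar> tau_0_plus (walk Y \<omega>) < tau_minus1 (walk Y \<omega>))"
  shows "\<P>(\<omega> in M. breaker_wins Breaker sM sB (\<lambda>v. children v \<omega>)) =
           \<rho> * (1 - \<sigma> * \<rho>_odd / (1 - \<theta> * (1 - \<theta>_odd)))
       \<and> \<P>(\<omega> in M. breaker_wins Maker sM sB (\<lambda>v. children v \<omega>)) =
           \<rho>\<^sup>2 * (1 - 2 * \<sigma> * \<rho>_odd * (1 - \<rho>_odd) / (1 - \<theta> * (1 - \<theta>_odd)))"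
proof -
  let ?Q = "map_pmf (\<lambda>x. x - 1) X"
  interpret W: skip_free_walk ?Q
    by unfold_locales (use separable_nonneg[OF separable] in auto)
  note walk = prob_walk_eq[OF \<open>prob_space N\<close> increments]
  have "pmf ?Q (-1) > 0"
    using separable_zero[OF separable \<open>pmf \<xi> 0 > 0\<close>] by (auto simp: pmf_positive_iff)
  note down = W.prob_down_at_even_times[OF this]
  have [measurable]: "Measurable.pred (iid_stream ?Q)
      (\<lambda>s. tau_0_plus (partial_sum s) = enat n \<and> enat n < tau_minus1 (partial_sum s))" for n
    unfolding return_before_minus1_at_iff by measurable
  have rho: "\<rho> = W.hit_prob UNIV"
    unfolding assms(10) W.hit_prob_def
    by (rule walk) (unfold tau_minus1_finite_iff, auto)
  have "\<P>(\<omega> in N. odd_time (tau_minus1 (walk Y \<omega>)) \<and> tau_minus1 (walk Y \<omega>) < \<infinity>) =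
      W.hit_prob {n. odd n}"
    unfolding W.hit_prob_def
    by (rule walk) (unfold tau_minus1_finite_iff odd_tau_minus1_iff, auto)
  then have "\<rho>_odd = W.hit_prob {n. odd n} / \<rho>"
    unfolding assms(13) assms(10) cond_prob_def by simp
  \<comment> \<open>If the condition has probability 0, the conditional probability is a division by
    0; the product formula survives because its left-hand side vanishes as well. The same applies to
    \<open>\<theta>_odd\<close> below.\<close>
  moreover have "W.hit_prob {n. odd n} = 0" if "\<rho> = 0"
    using that W.hit_prob_split unfolding rho by (simp add: W.hit_prob_def add_nonneg_eq_0_iff)
  ultimately have rho_odd: "W.hit_prob {n. odd n} = \<rho> * \<rho>_odd" by (cases "\<rho> = 0") auto
  have theta: "\<theta> = W.return_prob UNIV"
    unfolding assms(12) W.return_prob_def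
  proof (rule walk)
    show "Measurable.pred (iid_stream ?Q) (\<lambda>s. tau_0_plus (partial_sum s) < tau_minus1 (partial_sum s))"
      unfolding return_before_minus1_iff_Ex by measurable
    show "AE s in iid_stream ?Q. tau_0_plus (partial_sum s) < tau_minus1 (partial_sum s) \<longleftrightarrow>
        (\<exists>n\<in>UNIV. positive_return s n)"
      using W.AE_steps_ge by eventually_elim (simp add: return_before_minus1_iff)
  qed measurable
  have "\<P>(\<omega> in N. odd_time (tau_0_plus (walk Y \<omega>)) \<and> tau_0_plus (walk Y \<omega>) < tau_minus1 (walk Y \<omega>)) =
      W.return_prob {n. odd n}"
    unfolding W.return_prob_def
  proof (rule walk)
    show "Measurable.pred (iid_stream ?Q) (\<lambda>s. odd_time (tau_0_plus (partial_sum s)) \<and>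
        tau_0_plus (partial_sum s) < tau_minus1 (partial_sum s))"
      unfolding odd_return_before_minus1_iff_Ex by measurable
    show "AE s in iid_stream ?Q. (odd_time (tau_0_plus (partial_sum s)) \<and>
        tau_0_plus (partial_sum s) < tau_minus1 (partial_sum s)) \<longleftrightarrow>
        (\<exists>n\<in>{n. odd n}. positive_return s n)"
      using W.AE_steps_ge
    proof eventually_elim
      case (elim s)
      show ?case unfolding odd_return_before_minus1_iff[OF elim] by simp
    qed
  qed measurable
  then have "\<theta>_odd = W.return_prob {n. odd n} / \<theta>"
    unfolding assms(12,14) cond_prob_def by simp
  moreover have "W.return_prob {n. odd n} = 0" if "\<theta> = 0"
    using that W.return_prob_split unfolding theta by (simp add: W.return_prob_def add_nonneg_eq_0_iff)
  ultimately have "W.return_prob {n. odd n} = \<theta> * \<theta>_odd" by (cases "\<theta> = 0") auto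
  then have theta_even: "W.return_prob {n. even n} = \<theta> * (1 - \<theta>_odd)"
    using W.return_prob_split by (simp add: theta algebra_simps)
  have sigma: "\<sigma> = W.prob {s. \<forall>n\<ge>1. partial_sum s n > 0}"
    unfolding assms(11) by (rule walk) auto
  note wins = emeasure_breaker_wins_walk[OF separable \<open>prob_space M\<close> galton_watson
      \<open>legal_strategy sM\<close> \<open>legal_strategy sB\<close>]
  have "\<P>(\<omega> in M. breaker_wins Breaker sM sB (\<lambda>v. children v \<omega>)) =
      W.prob {s. down_at_parity 1 True s}"
    and "\<P>(\<omega> in M. breaker_wins Maker sM sB (\<lambda>v. children v \<omega>)) =
      W.prob {s. down_at_parity 2 True s}"
    by (simp_all only: measure_def wins)
  then show ?thesis
    \<comment> \<open>Hits at odd times have probability \<open>\<rho> * \<rho>_odd\<close> and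
      those at even times \<open>\<rho> * (1 - \<rho>_odd)\<close>, so the factors
      \<open>\<rho>\<close> and \<open>\<rho>\<^sup>2\<close> can be pulled out.\<close>
    unfolding down rho_odd theta_even rho[symmetric] sigma[symmetric]
    by (simp add: divide_inverse algebra_simps power2_eq_square)
qed

end
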